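(* Let $p>3$ be a prime and, for $n\in\mathbb{N}$, let $A_n=\sum_{k=0}^n\binom{n}{k}^2\binom{n+k}{k}^2$ be the Apéry numbers. Then $$\frac1p\sum_{k=0}^{p-1}(-1)^k(2k+1)A_k\equiv \left(\frac{p}{3}\right)+\frac{p^2}{6}B_{p-2}\left(\frac13\right)\pmod{p^3}.$$
   Context: $\left(\frac{\cdot}{3}\right)$ denotes the Legendre symbol. $B_n(x)=\sum_{k=0}^n\binom nk B_k x^{n-k}$ is the $n$th Bernoulli polynomial, where $B_k$ are the Bernoulli numbers. Congruences between rational numbers are understood in the ring of rationals whose denominators are coprime to $p$: $a\equiv b\pmod{p^m}$ means $(a-b)/p^m$ is such a rational. *)

theory Defs
  imports Complex_Main "HOL-Number_Theory.Number_Theory"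
begin

text \<open>Bernoulli numbers (convention B_1 = -1/2), defined by the standard recursion
  sum_{k=0}^{n} binom(n+1,k) B_k = 0 for n >= 1, B_0 = 1.\<close>
fun bernoulli_num :: "nat \<Rightarrow> rat" where
  "bernoulli_num n =
     (if n = 0 then 1
      else - (\<Sum>k<n. of_nat (Suc n choose k) * bernoulli_num k) / of_nat (Suc n))"

declare bernoulli_num.simps [simp del]

definition bernoulli_poly :: "nat \<Rightarrow> rat \<Rightarrow> rat" where
  "bernoulli_poly n x = (\<Sum>k\<le>n. of_nat (n choose k) * bernoulli_num k * x ^ (n - k))"

definition apery :: "nat \<Rightarrow> nat" where
  "apery n = (\<Sum>k\<le>n. (n choose k)^2 * ((n + k) choose k)^2)"

text \<open>Congruence of rationals modulo p^m: (a - b)/p^m has denominator coprime to p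
  (quotient_of gives the reduced representation with positive denominator).\<close>
definition rat_cong :: "rat \<Rightarrow> rat \<Rightarrow> int \<Rightarrow> nat \<Rightarrow> bool" where
  "rat_cong a b p m = coprime (snd (quotient_of ((a - b) / (of_int p) ^ m))) p"

end

theory Submission
  imports Defs
begin

text \<open>
  Put \<open>P(r,m) = binom(r,m) binom(r+m,m)\<close>, so that \<open>A_r\<close> is the sum of the \<open>P(r,m)^2\<close>, and let
  \<open>F_m\<close> be the alternating sum of \<open>(2r+1) P(r,m)^2\<close> over \<open>r < p\<close>, divided by \<open>p binom(2m,m)\<close>.
  The differences \<open>F_m - F_{m-1}\<close> have a closed form, and
  \<open>F_{p-1} = binom(2p,p)/2\<close> is 1 modulo \<open>p^3\<close>.  Summation by parts therefore expresses the left-hand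
  side through the partial sums of \<open>binom(2m,m)\<close>.  Those are equal to
  \<open>sum_k (k/3) binom(2i,i+k)\<close>, and a second telescoping reduces everything modulo \<open>p^3\<close> to
  \<open>(p/3) - Y\<close> with \<open>Y = sum_{0<k<p} (k/3) binom(2p,p+k)/binom(2p,p)\<close>.

  Since \<open>1 + w = -w^2\<close> for a primitive cube root of unity \<open>w\<close>, the sums \<open>sum_k binom(n,k) (k/3)\<close> and
  \<open>sum_k binom(n,k) (k/3)/k\<close> can be evaluated; for \<open>n = p\<close> and \<open>n = p-1\<close> they remove all harmonic
  numbers from \<open>Y\<close> and leave \<open>Y = -2 p^2 sum_k (-1)^(k-1) (k/3)/k^2\<close>.  The reflection \<open>k -> p-k\<close> and
  halving turn this last sum into \<open>(p/3)/6\<close> times the sum of \<open>1/k^2\<close> over \<open>k < p/3\<close>, which is a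
  value of a Bernoulli polynomial by Fermat and Faulhaber.
\<close>

section \<open>Exact evaluation of the alternating sum\<close>

definition apery_factor :: "nat \<Rightarrow> nat \<Rightarrow> rat" where
  "apery_factor n m = of_nat (n choose m) * of_nat ((n + m) choose m)"

text \<open>For \<open>n \<ge> 1\<close> this is \<open>binom(n-1,j) binom(n+j,j)\<close>. The
  product form shows it as \<open>(-1)^j\<close> times a product of factors
  \<open>1 - n^2/t^2\<close>, ready for expansion in powers of \<open>p\<close> when
  \<open>n = p\<close>.\<close>

definition square_prod :: "nat \<Rightarrow> nat \<Rightarrow> rat" where
  "square_prod n j = (\<Prod>t=1..j. (of_nat n ^ 2 - of_nat t ^ 2) / of_nat t ^ 2)"

definition central_binom :: "nat \<Rightarrow> rat" where "central_binom m = of_nat (2 * m choose m)"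

lemma central_binom_pos: "central_binom m > 0" by (simp add: central_binom_def)

lemma central_binom_Suc: "of_nat (Suc m) * central_binom (Suc m)
    = 2 * (2 * of_nat m + 1) * central_binom m"
proof -
  have "Suc m * (2 * Suc m choose Suc m) = 2 * (Suc m * (Suc (2 * m) choose m))"
    using Suc_times_binomial_eq[of "Suc (2*m)" m] by (simp add: algebra_simps)
  also have "Suc m * (Suc (2 * m) choose m) = Suc (2*m) * (2 * m choose m)"
    using Suc_times_binomial_add[of m m] Suc_times_binomial[of m "2*m"]
      binomial_symmetric[of m "Suc (2*m)"] Suc_times_binomial_eq[of "2*m" m]
    by (simp add: mult_2 algebra_simps)
  finally have "Suc m * (2 * Suc m choose Suc m) = 2 * (Suc (2*m) * (2 * m choose m))" .
  then have "of_nat (Suc m * (2 * Suc m choose Suc m))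
      = (of_nat (2 * (Suc (2*m) * (2 * m choose m))) :: rat)"
    by (simp only:)
  then show ?thesis unfolding central_binom_def by (simp add: algebra_simps)
qed

lemma choose_Suc_rat: "of_nat (Suc k) * of_nat (n choose Suc k)
    = (of_nat n - of_nat k) * (of_nat (n choose k) :: rat)"
  using gbinomial_mult_1[of "of_nat n :: rat" k] by (simp add: binomial_gbinomial algebra_simps)

lemma apery_factor_0 [simp]: "apery_factor n 0 = 1" by (simp add: apery_factor_def)

lemma apery_factor_Suc: "apery_factor n (Suc m)
    = apery_factor n m * (of_nat n - of_nat m) * (of_nat n + of_nat m + 1) / of_nat (Suc m) ^ 2"
proof -
  have "of_nat (Suc m) * of_nat ((n + Suc m) choose Suc m)
      = (of_nat (Suc (n+m)) * of_nat ((n+m) choose m) :: rat)"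
    using arg_cong[OF Suc_times_binomial_eq[of "n+m" m], of "of_nat :: nat \<Rightarrow> rat"]
    by (simp only: of_nat_mult add_Suc_right) (simp add: mult.commute)
  with choose_Suc_rat[of m n] have
    "(of_nat (Suc m) * of_nat (n choose Suc m)) * (of_nat (Suc m) * of_nat ((n + Suc m) choose Suc m))
      = ((of_nat n - of_nat m) * (of_nat (n choose m) :: rat))
          * (of_nat (Suc (n+m)) * of_nat ((n+m) choose m))"
    by (simp only:)
  then have "of_nat (Suc m) ^ 2 * apery_factor n (Suc m)
      = apery_factor n m * (of_nat n - of_nat m) * (of_nat n + of_nat m + 1)"
    unfolding apery_factor_def by (simp add: power2_eq_square algebra_simps del: binomial_Suc_Suc)
  then show ?thesis by (simp add: eq_divide_eq mult.commute del: of_nat_Suc)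
qed

lemma square_prod_0 [simp]: "square_prod n 0 = 1" by (simp add: square_prod_def)

lemma square_prod_Suc: "square_prod n (Suc j)
    = square_prod n j * (of_nat n - of_nat (Suc j)) * (of_nat n + of_nat (Suc j)) / of_nat (Suc j) ^ 2"
  by (simp add: square_prod_def power2_eq_square algebra_simps)

text \<open>Together with \<open>square_prod_Suc_factor\<close>, this expresses
  \<open>square_prod\<close> at \<open>n\<close> and at \<open>n + 1\<close> through the same
  \<open>apery_factor n j\<close>, which reduces the induction step of \<open>alt_sum_Suc\<close> to
  a polynomial identity.\<close>

lemma square_prod_factor: "of_nat n * square_prod n j = apery_factor n j * (of_nat n - of_nat j)"
proof (induction j)
  case (Suc j)
  have "of_nat n * square_prod n (Suc j)
      = (of_nat n * square_prod n j) * (of_nat n - of_nat (Suc j)) * (of_nat n + of_nat (Suc j))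
      / of_nat (Suc j) ^ 2"
    by (simp add: square_prod_Suc)
  then show ?case unfolding Suc apery_factor_Suc by (simp add: algebra_simps)
qed simp

lemma square_prod_Suc_factor: "of_nat (Suc n) * square_prod (Suc n) j
    = apery_factor n j * (of_nat n + of_nat j + 1)"
proof (induction j)
  case (Suc j)
  have "of_nat (Suc n) * square_prod (Suc n) (Suc j)
      = (of_nat (Suc n) * square_prod (Suc n) j) * (of_nat (Suc n) - of_nat (Suc j))
      * (of_nat (Suc n) + of_nat (Suc j)) / of_nat (Suc j) ^ 2"
    by (simp add: square_prod_Suc)
  then show ?case unfolding Suc apery_factor_Suc by (simp add: algebra_simps)
qed simp

text \<open>For \<open>n = p\<close> this is \<open>p binom(2m,m) F_m\<close>. The upper limit is
  kept free because the closed form below is proved by induction on it.\<close>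

definition alt_sum :: "nat \<Rightarrow> nat \<Rightarrow> rat" where
  "alt_sum m n = (\<Sum>r<n. (-1)^r * of_nat (2 * r + 1) * apery_factor r m ^ 2)"

text \<open>The polynomial core of \<open>alt_sum_Suc\<close>: up to a common factor, the left side
  is the increment of the closed form from \<open>n\<close> to \<open>n + 1\<close>, and the right
  side is the summand for \<open>r = n\<close>.\<close>

lemma alt_sum_step_identity: fixes n m :: rat
  shows "- ((n + 1) * (3 * (m+1)^2 - (n + 1)^2) * (n + m + 1)^2) - n * (3 * (m+1)^2 - n^2) * (n - m)^2
    = (2 * n + 1) * ((n - m)^2 * (n + m + 1)^2 - 2 * (2 * m + 1) * (m+1)^3)"
  by (simp add: algebra_simps power2_eq_square power3_eq_cube)

text \<open>The right side is an explicit antidifference in \<open>n\<close> of the summand: it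
  vanishes at \<open>n = 0\<close> because of the factor \<open>n^3\<close>, and its increments are
  checked with \<open>j\<close> fixed.\<close>

lemma alt_sum_Suc:
  "alt_sum (Suc j) n / central_binom (Suc j) - alt_sum j n / central_binom j =
   (-1)^n * of_nat n ^ 3 * (3 * of_nat (Suc j) ^ 2 - of_nat n ^ 2) * square_prod n j ^ 2
       / (of_nat (Suc j) ^ 4 * central_binom (Suc j))"
proof (induction n)
  case 0 then show ?case by (simp add: alt_sum_def)
next
  case (Suc n)
  define N where "N = (of_nat n :: rat)"
  define M where "M = (of_nat j :: rat)"
  define v where "v = apery_factor n j"
  define s where "s = ((-1)^n :: rat)"
  define c where "c = central_binom (Suc j)"
  have c: "c \<noteq> 0" using central_binom_pos[of "Suc j"] by (simp add: c_def)
  have M: "M + 1 \<noteq> 0" "2 * M + 1 \<noteq> 0"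
  proof -
    have "M \<ge> 0" by (simp add: M_def)
    then show "M + 1 \<noteq> 0" "2 * M + 1 \<noteq> 0" by linarith+
  qed
  \<comment> \<open>Both normalisations are expressed through the single quantity \<open>c\<close>,
    so that a common factor \<open>s * v^2 / ((M+1)^4 * c)\<close> can be pulled out.\<close>
  have cj: "central_binom j = (M + 1) * c / (2 * (2 * M + 1))"
    using central_binom_Suc[of j] M by (simp add: c_def M_def field_simps)
  have w: "N * square_prod n j = v * (N - M)" "(N + 1) * square_prod (Suc n) j = v * (N + M + 1)"
    using square_prod_factor[of n j] square_prod_Suc_factor[of n j]
        by (simp_all add: N_def M_def v_def algebra_simps)
  have pp: "apery_factor n (Suc j) = v * (N - M) * (N + M + 1) / (M + 1)^2"
    by (simp add: apery_factor_Suc N_def M_def v_def add.commute)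
  have "alt_sum (Suc j) (Suc n) / c - alt_sum j (Suc n) / central_binom j
     = (alt_sum (Suc j) n / c - alt_sum j n / central_binom j)
         + s * (2 * N + 1) * (apery_factor n (Suc j) ^ 2 / c - v ^ 2 / central_binom j)"
    by (simp add: alt_sum_def s_def N_def v_def diff_divide_distrib add_divide_distrib algebra_simps)
  also have "alt_sum (Suc j) n / c - alt_sum j n / central_binom j
      = s * N * (3 * (M + 1)^2 - N^2) * (N * square_prod n j)^2 / ((M+1)^4 * c)"
    using Suc by (simp add: c_def s_def N_def M_def power2_eq_square power3_eq_cube algebra_simps)
  also have "\<dots> = s * v^2 / ((M+1)^4 * c) * (N * (3 * (M + 1)^2 - N^2) * (N - M)^2)"
    unfolding w by (simp add: power_mult_distrib)
  also have "s * (2 * N + 1) * (apery_factor n (Suc j) ^ 2 / c - v ^ 2 / central_binom j)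
     = s * v^2 / ((M+1)^4 * c) * ((2 * N + 1) * ((N - M)^2 * (N + M + 1)^2 - 2 * (2 * M + 1) * (M+1)^3))"
  proof -
    have "apery_factor n (Suc j) ^ 2 / c = v^2 / ((M+1)^4 * c) * ((N - M)^2 * (N + M + 1)^2)"
      unfolding pp using M c by (simp add: power_mult_distrib power_divide flip: power_mult)
    moreover have "v ^ 2 / central_binom j = v^2 / ((M+1)^4 * c) * (2 * (2 * M + 1) * (M+1)^3)"
    proof -
      have "v ^ 2 / (q * c / (2 * (2 * M + 1))) = v^2 / (q^4 * c) * (2 * (2 * M + 1) * q^3)"
          if "q \<noteq> 0" for q
        using M(2) c that by (simp add: power4_eq_xxxx power3_eq_cube)
      then show ?thesis unfolding cj using M(1) by blast
    qed
    ultimately show ?thesis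
        by (simp only: right_diff_distrib mult.assoc times_divide_eq_left times_divide_eq_right)
        (simp add: mult_ac)
  qed
  also have "s * v^2 / ((M+1)^4 * c) * (N * (3 * (M + 1)^2 - N^2) * (N - M)^2) +
     s * v^2 / ((M+1)^4 * c) * ((2 * N + 1) * ((N - M)^2 * (N + M + 1)^2 - 2 * (2 * M + 1) * (M+1)^3))
     = s * v^2 / ((M+1)^4 * c) * (- ((N + 1) * (3 * (M+1)^2 - (N + 1)^2) * (N + M + 1)^2))"
    unfolding alt_sum_step_identity[symmetric] by (simp add: algebra_simps)
  also have "\<dots> = - s * (N+1) * (3 * (M + 1)^2 - (N+1)^2) * (v * (N + M + 1))^2 / ((M+1)^4 * c)"
    by (simp add: power_mult_distrib mult_ac)
  also have "\<dots> = (-1)^Suc n * of_nat (Suc n) ^ 3 * (3 * of_nat (Suc j) ^ 2 - of_nat (Suc n) ^ 2)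
      * square_prod (Suc n) j ^ 2 / (of_nat (Suc j) ^ 4 * central_binom (Suc j))"
    unfolding w(2)[symmetric]
        by (simp add: c_def s_def N_def M_def power_mult_distrib power2_eq_square power3_eq_cube
        add.commute mult.assoc)
  finally show ?case by (simp add: c_def)
qed

section \<open>The character modulo 3 and partial sums of central binomial coefficients\<close>

definition chi3 :: "int \<Rightarrow> int" where
  "chi3 k = (if k mod 3 = 1 then 1 else if k mod 3 = 2 then -1 else 0)"

lemma chi3_0 [simp]: "chi3 0 = 0" and chi3_1 [simp]: "chi3 1 = 1"
  by (simp_all add: chi3_def)

lemma chi3_add_mod: "chi3 (k + c) = chi3 (k mod 3 + c)"
  by (simp add: chi3_def mod_add_left_eq)

lemma mod_3_cases: "k mod 3 \<in> {0, 1, 2 :: int}"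
  using pos_mod_bound[of 3 k] pos_mod_sign[of 3 k] by auto

text \<open>Three consecutive values are 0, 1, -1 in some order, so they add up to 0; this is the
  counterpart of \<open>1 + w + w^2 = 0\<close>.\<close>

lemma chi3_three_term: "chi3 (k + 2) = - chi3 (k + 1) - chi3 k"
proof -
  obtain r where r: "r \<in> {0, 1, 2}" "\<And>c. chi3 (k + c) = chi3 (r + c)"
    using mod_3_cases chi3_add_mod by blast
  then have "chi3 (r + 2) = - chi3 (r + 1) - chi3 (r + 0)" by (auto simp: chi3_def)
  then show ?thesis unfolding r(2)[symmetric] by simp
qed

lemma chi3_diff_1: "chi3 (k - 1) = - chi3 k - chi3 (k + 1)"
  using chi3_three_term[of "k - 1"] by (simp add: add.commute)

lemma chi3_uminus: "chi3 (- k) = - chi3 k"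
proof -
  obtain r where r: "r \<in> {0, 1, 2}" "k mod 3 = r" "(- k) mod 3 = (- r) mod 3"
    using mod_3_cases mod_minus_eq by metis
  then show ?thesis unfolding chi3_def r by auto
qed

text \<open>Collecting the coefficient of each \<open>b j\<close> gives
  \<open>chi3 (j - 1) + chi3 j + chi3 (j + 1) = 0\<close> in the interior, so only boundary terms
  survive: \<open>b 0\<close> comes from \<open>k = 1\<close>, the others from the upper
  end.\<close>

lemma sum_chi_telescope:
  fixes b :: "nat \<Rightarrow> rat"
  shows "(\<Sum>k=1..n. of_int (chi3 (int k)) * (b (k + 1) + b k + b (k - 1)))
    = b 0 + of_int (chi3 (int n)) * b (n + 1) - of_int (chi3 (int n + 1)) * b n"
proof (induction n)
  case (Suc n)
  have c: "chi3 (int (Suc n) + 1) = - chi3 (int n + 1) - chi3 (int n)"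
    using chi3_three_term[of "int n"] by (simp add: add.commute)
  have "(\<Sum>k=1..Suc n. of_int (chi3 (int k)) * (b (k + 1) + b k + b (k - 1)))
    = b 0 + of_int (chi3 (int n)) * b (n + 1) - of_int (chi3 (int n + 1)) * b n
      + of_int (chi3 (int n + 1)) * (b (n + 2) + b (n + 1) + b n)"
    using Suc by (simp add: add.commute)
  also have "\<dots> = b 0 + of_int (chi3 (int (Suc n))) * b (Suc n + 1)
      - of_int (chi3 (int (Suc n) + 1)) * b (Suc n)"
    unfolding c by (simp add: algebra_simps)
  finally show ?case .
qed simp

definition central_binom_sum :: "nat \<Rightarrow> rat" where "central_binom_sum n = (\<Sum>m<n. central_binom m)"

text \<open>Pascal's rule applied twice; \<open>k \<ge> 1\<close> ensures that \<open>k - 1\<close>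
  is a genuine predecessor.\<close>

lemma choose_double_Suc:
  assumes "k \<ge> 1"
  shows "(2 * Suc n choose (Suc n + k))
      = (2 * n choose (n + (k + 1))) + 2 * (2 * n choose (n + k)) + (2 * n choose (n + (k - 1)))"
proof -
  obtain l where "k = Suc l" using assms by (cases k) auto
  then show ?thesis by simp
qed

text \<open>Raising \<open>n\<close> replaces \<open>b k\<close> by
  \<open>b (k + 1) + 2 b k + b (k - 1)\<close>. One copy of \<open>b k\<close> reproduces the old
  sum, and the remaining three terms telescope against \<open>chi3\<close>.\<close>

lemma central_binom_sum_chi: "central_binom_sum n
    = (\<Sum>k=1..n. of_int (chi3 (int k)) * of_nat (2 * n choose (n + k)))"
proof (induction n)
  case 0 then show ?case by (simp add: central_binom_sum_def)
next
  case (Suc n)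
  define b where "b = (\<lambda>k. of_nat (2 * n choose (n + k)) :: rat)"
  have b0: "b (Suc n) = 0" "b (Suc (Suc n)) = 0"
    unfolding b_def by (simp_all add: binomial_eq_0_iff)
  have "(\<Sum>k=1..Suc n. of_int (chi3 (int k)) * of_nat (2 * Suc n choose (Suc n + k)))
      = (\<Sum>k=1..Suc n. of_int (chi3 (int k)) * (b (k + 1) + b k + b (k - 1))
          + of_int (chi3 (int k)) * b k)"
  proof (intro sum.cong refl)
    fix k assume "k \<in> {1..Suc n}"
    then have "of_nat (2 * Suc n choose (Suc n + k)) = b (k + 1) + 2 * b k + b (k - 1)"
      by (subst choose_double_Suc) (simp_all add: b_def)
    then show "of_int (chi3 (int k)) * of_nat (2 * Suc n choose (Suc n + k))
      = of_int (chi3 (int k)) * (b (k + 1) + b k + b (k - 1)) + of_int (chi3 (int k)) * b k"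
      by (simp only:) (simp add: algebra_simps)
  qed
  \<comment> \<open>The boundary terms \<open>b (n + 1)\<close> and \<open>b (n + 2)\<close> vanish;
    \<open>b 0\<close> is the new summand \<open>central_binom n\<close>.\<close>
  also have "\<dots> = b 0 + (\<Sum>k=1..n. of_int (chi3 (int k)) * b k)"
    unfolding sum.distrib sum_chi_telescope using b0 by simp
  also have "\<dots> = central_binom_sum (Suc n)"
    unfolding central_binom_sum_def using Suc
        by (simp add: b_def central_binom_def central_binom_sum_def)
  finally show ?case ..
qed

definition binom_ratio :: "nat \<Rightarrow> nat \<Rightarrow> rat" where
  "binom_ratio n k = of_nat (2 * n choose (n + k)) / central_binom n"

lemma binom_ratio_fact: "k \<le> n \<Longrightarrow> binom_ratio n k = fact n ^ 2 / (fact (n - k) * fact (n + k))"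
proof -
  assume "k \<le> n"
  then have "of_nat (2 * n choose (n + k)) = (fact (2 * n) / (fact (n + k) * fact (n - k)) :: rat)"
    by (subst binomial_fact) (auto simp: mult_2)
  moreover have "central_binom n = fact (2 * n) / (fact n * fact n)"
    unfolding central_binom_def by (subst binomial_fact) (auto simp: mult_2)
  ultimately show ?thesis by (simp add: binom_ratio_def power2_eq_square)
qed

lemma binom_ratio_eq_0: "k > n \<Longrightarrow> binom_ratio n k = 0"
  by (simp add: binom_ratio_def)

text \<open>For \<open>k \<le> n\<close> this is the quotient of the factorial formulas. Cleared of
  denominators it extends to \<open>k > n\<close>, where both sides are 0.\<close>

lemma binom_ratio_Suc: "binom_ratio n k * of_nat (Suc n) ^ 2
    = binom_ratio (Suc n) k * (of_nat (Suc n) ^ 2 - of_nat k ^ 2)"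
proof -
  consider "k \<le> n" | "k = Suc n" | "k > Suc n" by linarith
  then show ?thesis
  proof cases
    case 1
    have f: "fact (Suc n - k) = (of_nat (Suc n) - of_nat k) * (fact (n - k) :: rat)"
      using 1 by (simp add: Suc_diff_le of_nat_diff)
    have ne: "of_nat (Suc n) - of_nat k \<noteq> (0::rat)" "of_nat (Suc n) + of_nat k \<noteq> (0::rat)"
      using 1 by (simp_all add: of_nat_diff[symmetric] Suc_diff_le flip: of_nat_add del: of_nat_Suc)
    define A where "A = of_nat (Suc n) - (of_nat k :: rat)"
    define B where "B = of_nat (Suc n) + (of_nat k :: rat)"
    have "binom_ratio (Suc n) k
        = (of_nat (Suc n) * fact n)^2 / ((A * fact (n - k)) * (B * fact (n + k)))"
      using 1 by (subst binom_ratio_fact) (simp_all add: f A_def B_def add_ac)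
    then have "binom_ratio (Suc n) k * (A * B) = of_nat (Suc n) ^ 2 * binom_ratio n k"
      using ne 1 unfolding A_def[symmetric] B_def[symmetric]
          by (simp add: binom_ratio_fact[OF 1] power_mult_distrib)
    moreover have "A * B = of_nat (Suc n) ^ 2 - of_nat k ^ 2"
      by (simp add: A_def B_def power2_eq_square algebra_simps)
    ultimately show ?thesis by (simp add: mult.commute)
  qed (simp_all add: binom_ratio_eq_0)
qed

definition ratio_sum :: "nat \<Rightarrow> rat" where
  "ratio_sum n = (\<Sum>k=1..n. of_int (chi3 (int k)) * binom_ratio n k)"

lemma central_binom_sum_eq_ratio_sum: "central_binom_sum n = central_binom n * ratio_sum n"
  using central_binom_pos[of n]
      by (simp add: central_binom_sum_chi ratio_sum_def binom_ratio_def sum_distrib_left)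

text \<open>By \<open>binom_ratio_Suc\<close>, passing from \<open>n\<close> to \<open>n + 1\<close>
  changes \<open>binom_ratio n k / k^2\<close> by \<open>binom_ratio (n + 1) k / (n + 1)^2\<close>.
  Weighted with \<open>chi3\<close> and summed over \<open>k\<close>, this change is the new term on
  the left.\<close>

lemma sum_ratio_sum: "(\<Sum>i=1..n. ratio_sum i / of_nat i ^ 2)
    = (\<Sum>k=1..n. of_int (chi3 (int k)) * binom_ratio n k / of_nat k ^ 2)"
proof (induction n)
  case (Suc n)
  have *: "binom_ratio (Suc n) k / of_nat k ^ 2
      = binom_ratio n k / of_nat k ^ 2 + binom_ratio (Suc n) k / of_nat (Suc n) ^ 2"
    if "k \<in> {1..Suc n}" for k
  proof -
    have k: "(of_nat k :: rat) \<noteq> 0" using that by simp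
    have "binom_ratio n k
        = binom_ratio (Suc n) k * (of_nat (Suc n) ^ 2 - of_nat k ^ 2) / of_nat (Suc n) ^ 2"
      using binom_ratio_Suc[of n k] by (simp add: field_simps del: of_nat_Suc)
    also have "\<dots> = binom_ratio (Suc n) k - binom_ratio (Suc n) k * of_nat k ^ 2 / of_nat (Suc n) ^ 2"
      by (simp add: right_diff_distrib diff_divide_distrib del: of_nat_Suc)
    finally show ?thesis using k by (simp add: field_simps del: of_nat_Suc)
  qed
  have "(\<Sum>k=1..Suc n. of_int (chi3 (int k)) * binom_ratio (Suc n) k / of_nat k ^ 2)
     = (\<Sum>k=1..Suc n. of_int (chi3 (int k)) * binom_ratio n k / of_nat k ^ 2
         + of_int (chi3 (int k)) * binom_ratio (Suc n) k / of_nat (Suc n) ^ 2)"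
    by (intro sum.cong refl) (simp only: times_divide_eq_right[symmetric] * distrib_left)
  also have "\<dots> = (\<Sum>k=1..n. of_int (chi3 (int k)) * binom_ratio n k / of_nat k ^ 2)
      + ratio_sum (Suc n) / of_nat (Suc n) ^ 2"
    unfolding sum.distrib ratio_sum_def sum_divide_distrib by (simp add: binom_ratio_eq_0)
  finally show ?case using Suc by simp
qed simp

section \<open>Binomial sums weighted by the character\<close>

lemma sum_choose_Suc:
  fixes f :: "nat \<Rightarrow> int"
  shows "(\<Sum>k\<le>Suc n. int (Suc n choose k) * f k) = (\<Sum>k\<le>n. int (n choose k) * (f k + f (Suc k)))"
proof -
  have "(\<Sum>k\<le>n. int (n choose k) * f k) = (\<Sum>k\<le>Suc n. int (n choose k) * f k)" by simp
  also have "\<dots> = f 0 + (\<Sum>k\<le>n. int (n choose Suc k) * f (Suc k))"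
    by (subst sum.atMost_Suc_shift) simp
  finally show ?thesis
    by (subst sum.atMost_Suc_shift) (simp add: distrib_left distrib_right sum.distrib)
qed

text \<open>\<open>chi3\<close> is a linear combination of \<open>w^k\<close> and
  \<open>w^(-k)\<close>, and \<open>w^s (1 + w)^n = (-1)^n w^(s-n)\<close>. The induction avoids
  complex numbers but has to run over all shifts \<open>s\<close>, since Pascal's rule produces
  \<open>s\<close> and \<open>s + 1\<close>.\<close>

lemma sum_choose_chi: "(\<Sum>k\<le>n. int (n choose k) * chi3 (s + int k)) = (-1)^n * chi3 (s - int n)"
proof (induction n arbitrary: s)
  case (Suc n)
  have "(\<Sum>k\<le>Suc n. int (Suc n choose k) * chi3 (s + int k))
      = (\<Sum>k\<le>n. int (n choose k) * chi3 (s + int k)) + (\<Sum>k\<le>n. int (n choose k) * chi3 ((s + 1) + int k))"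
    by (subst sum_choose_Suc) (simp add: distrib_left sum.distrib add_ac)
  also have "\<dots> = (-1)^n * (chi3 (s - int n) + chi3 (s - int n + 1))"
    unfolding Suc by (simp add: algebra_simps)
  also have "chi3 (s - int n) + chi3 (s - int n + 1) = - chi3 (s - int n - 1)"
    by (simp add: chi3_diff_1)
  finally show ?case by (simp add: algebra_simps)
qed simp

lemma sum_choose_chi_rat:
  "(\<Sum>k=1..n. of_nat (n choose k) * of_int (chi3 (int k))) = ((-1)^Suc n * of_int (chi3 (int n)) :: rat)"
proof -
  have "(\<Sum>k\<le>n. int (n choose k) * chi3 (int k)) = (-1)^Suc n * chi3 (int n)"
    using sum_choose_chi[of n 0] by (simp add: chi3_uminus)
  then have "of_int (\<Sum>k\<le>n. int (n choose k) * chi3 (int k))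
      = (of_int ((-1)^Suc n * chi3 (int n)) :: rat)"
    by (simp only:)
  then show ?thesis by (simp add: atMost_atLeast0 sum.atLeast_Suc_atMost)
qed

text \<open>Since \<open>binom(n,k-1) / k = binom(n+1,k) / (n+1)\<close>, the increment in
  \<open>n\<close> is \<open>1/(n+1)\<close> times the sum already evaluated in
  \<open>sum_choose_chi_rat\<close>.\<close>

lemma sum_choose_chi_div:
  "(\<Sum>k=1..n. of_nat (n choose k) * of_int (chi3 (int k)) / of_nat k)
    = (\<Sum>k=1..n. (-1)^Suc k * of_int (chi3 (int k)) / (of_nat k :: rat))"
proof (induction n)
  case (Suc n)
  have *: "(of_nat (Suc n choose k) :: rat) / of_nat k
      = of_nat (n choose k) / of_nat k + of_nat (Suc n choose k) / of_nat (Suc n)"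
    if k: "k \<in> {1..Suc n}" for k
  proof -
    obtain l where l: "k = Suc l" using k by (cases k) auto
    have "of_nat (Suc l) * (of_nat (Suc n choose Suc l) :: rat) = of_nat (Suc n) * of_nat (n choose l)"
      by (simp only: of_nat_mult[symmetric] Suc_times_binomial)
    then have "(of_nat (n choose l) :: rat) / of_nat (Suc l)
        = of_nat (Suc n choose Suc l) / of_nat (Suc n)"
      by (simp add: frac_eq_eq mult.commute del: of_nat_Suc binomial_Suc_Suc)
    then show ?thesis unfolding l by (simp add: add_divide_distrib)
  qed
  have "(\<Sum>k=1..Suc n. of_nat (Suc n choose k) * of_int (chi3 (int k)) / (of_nat k :: rat))
    = (\<Sum>k=1..Suc n. of_nat (n choose k) * of_int (chi3 (int k)) / of_nat k
        + of_nat (Suc n choose k) * of_int (chi3 (int k)) / of_nat (Suc n))"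
    by (intro sum.cong refl) (simp only: times_divide_eq_left[symmetric] * distrib_right)
  also have "\<dots> = (\<Sum>k=1..n. of_nat (n choose k) * of_int (chi3 (int k)) / of_nat k)
     + (\<Sum>k=1..Suc n. of_nat (Suc n choose k) * of_int (chi3 (int k))) / of_nat (Suc n)"
    by (simp only: sum.distrib sum_divide_distrib[symmetric]) (simp add: binomial_eq_0)
  also have "\<dots> = (\<Sum>k=1..Suc n. (-1)^Suc k * of_int (chi3 (int k)) / of_nat k)"
    unfolding Suc sum_choose_chi_rat by simp
  finally show ?case .
qed simp

section \<open>Summation by parts for the weighted sum of Apery numbers\<close>

lemma sum_by_parts:
  fixes c F :: "nat \<Rightarrow> rat"
  shows "(\<Sum>m<Suc N. c m * F m) = F N * (\<Sum>m<Suc N. c m) + (\<Sum>i=1..N. (F (i - 1) - F i) * (\<Sum>m<i. c m))"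
  by (induction N) (simp_all add: algebra_simps)

text \<open>The factors with \<open>m > k\<close> vanish, so one range \<open>m < n\<close> serves
  all \<open>k\<close> and the double sum can be interchanged.\<close>

lemma apery_eq_sum_factors: "k < n \<Longrightarrow> of_nat (apery k) = (\<Sum>m<n. apery_factor k m ^ 2)"
proof -
  assume "k < n"
  have "(\<Sum>m<n. apery_factor k m ^ 2) = (\<Sum>m\<le>k. apery_factor k m ^ 2)"
    by (rule sum.mono_neutral_right) (use \<open>k < n\<close> in \<open>auto simp: apery_factor_def\<close>)
  then show ?thesis by (simp add: apery_def apery_factor_def power_mult_distrib)
qed

lemma sum_apery_eq_alt_sum: "(\<Sum>k<n. (-1)^k * of_nat (2 * k + 1) * of_nat (apery k))
    = (\<Sum>m<n. alt_sum m n)"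
proof -
  have "(\<Sum>k<n. (-1)^k * of_nat (2 * k + 1) * (of_nat (apery k) :: rat))
      = (\<Sum>k<n. \<Sum>m<n. (-1)^k * of_nat (2 * k + 1) * apery_factor k m ^ 2)"
    by (intro sum.cong refl) (simp add: apery_eq_sum_factors sum_distrib_left)
  also have "\<dots> = (\<Sum>m<n. alt_sum m n)" unfolding alt_sum_def by (rule sum.swap)
  finally show ?thesis .
qed

lemma apery_factor_diag: "apery_factor N N = central_binom N"
  by (simp add: apery_factor_def central_binom_def mult_2)

text \<open>Only \<open>r = N\<close> contributes, because \<open>binom(r,N) = 0\<close> for
  \<open>r < N\<close>.\<close>

lemma alt_sum_last: "alt_sum N (Suc N) = (-1)^N * of_nat (2 * N + 1) * central_binom N ^ 2"
proof -
  have "(\<Sum>r<N. (-1)^r * of_nat (2 * r + 1) * apery_factor r N ^ 2) = 0"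
    by (intro sum.neutral) (simp add: apery_factor_def binomial_eq_0)
  then show ?thesis by (simp add: alt_sum_def apery_factor_diag)
qed

text \<open>With \<open>n = N + 1\<close> the product is \<open>binom(2n-1,n-1)\<close>, which is
  half of \<open>binom(2n,n)\<close>.\<close>

lemma central_binom_eq_square_prod: "central_binom (Suc N) = 2 * square_prod (Suc N) N"
proof -
  have "of_nat (Suc N) * square_prod (Suc N) N = central_binom N * (2 * of_nat N + 1)"
    unfolding square_prod_Suc_factor by (simp add: apery_factor_diag)
  then have "of_nat (Suc N) * central_binom (Suc N) = of_nat (Suc N) * (2 * square_prod (Suc N) N)"
    using central_binom_Suc[of N] by (simp add: algebra_simps)
  then show ?thesis by (simp del: of_nat_Suc)
qed

text \<open>An exact identity, before any reduction modulo \<open>p\<close>. Parity enters twice: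
  \<open>(-1)^N = 1\<close> in the last value \<open>F N\<close>, and \<open>(-1)^n = -1\<close>
  cancels the minus sign of \<open>F (i - 1) - F i\<close>.\<close>

lemma apery_sum_eq:
  assumes "odd n" "n = Suc N"
  shows "(1 / of_nat n) * (\<Sum>k<n. (-1)^k * of_nat (2 * k + 1) * of_nat (apery k))
    = square_prod n N * central_binom_sum n
        + (\<Sum>i=1..N. of_nat n ^ 2 / of_nat i ^ 2 * (3 - of_nat n ^ 2 / of_nat i ^ 2)
        * square_prod n (i - 1) ^ 2 * ratio_sum i)"
proof -
  define F where "F = (\<lambda>m. alt_sum m n / (of_nat n * central_binom m))"
  have n0: "(of_nat n :: rat) \<noteq> 0" using assms by simp
  have c0: "central_binom m \<noteq> 0" for m using central_binom_pos[of m] by simp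
  have "(1 / of_nat n) * (\<Sum>k<n. (-1)^k * of_nat (2 * k + 1) * of_nat (apery k))
      = (\<Sum>m<Suc N. central_binom m * F m)"
    unfolding sum_apery_eq_alt_sum sum_distrib_left assms(2)[symmetric]
    by (intro sum.cong refl) (simp add: F_def c0)
  also have "\<dots> = F N * central_binom_sum n + (\<Sum>i=1..N. (F (i - 1) - F i) * central_binom_sum i)"
    unfolding sum_by_parts central_binom_sum_def assms(2) ..
  also have "F N = square_prod n N"
  proof -
    have "even N" using assms by simp
    then have "alt_sum N n = of_nat (2 * N + 1) * central_binom N ^ 2" unfolding assms(2)
        by (simp add: alt_sum_last)
    moreover have "of_nat n * square_prod n N = central_binom N * (2 * of_nat N + 1)"
      unfolding assms(2) square_prod_Suc_factor by (simp add: apery_factor_diag)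
    ultimately have "alt_sum N n = of_nat n * square_prod n N * central_binom N"
      by (simp add: power2_eq_square)
    then show ?thesis using n0 c0[of N] by (simp add: F_def)
  qed
  also have "(\<Sum>i=1..N. (F (i - 1) - F i) * central_binom_sum i)
     = (\<Sum>i=1..N. of_nat n ^ 2 / of_nat i ^ 2 * (3 - of_nat n ^ 2 / of_nat i ^ 2)
         * square_prod n (i - 1) ^ 2 * ratio_sum i)"
  proof (intro sum.cong refl)
    fix i assume "i \<in> {1..N}"
    then obtain j where i: "i = Suc j" by (cases i) auto
    define I where "I = (of_nat i :: rat)"
    have I: "I \<noteq> 0" by (simp add: I_def i)
    have "F (i - 1) - F i
        = - ((alt_sum (Suc j) n / central_binom (Suc j) - alt_sum j n / central_binom j) / of_nat n)"
      by (simp add: F_def i diff_divide_distrib mult.commute)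
    also have "\<dots> = of_nat n ^ 2 * (3 * I ^ 2 - of_nat n ^ 2) * square_prod n j ^ 2
        / (I ^ 4 * central_binom i)"
      unfolding alt_sum_Suc using n0 assms(1)
          by (simp add: i I_def power3_eq_cube power2_eq_square del: of_nat_Suc)
    finally have "(F (i - 1) - F i) * central_binom_sum i
        = of_nat n ^ 2 * (3 * I ^ 2 - of_nat n ^ 2) * square_prod n j ^ 2 / I ^ 4 * ratio_sum i"
      using c0[of i] by (simp add: central_binom_sum_eq_ratio_sum)
    also have "\<dots> = of_nat n ^ 2 / I ^ 2 * (3 - of_nat n ^ 2 / I ^ 2) * square_prod n j ^ 2 * ratio_sum i"
      using I by (simp add: field_simps power4_eq_xxxx power2_eq_square)
    finally show "(F (i - 1) - F i) * central_binom_sum i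
        = of_nat n ^ 2 / of_nat i ^ 2 * (3 - of_nat n ^ 2 / of_nat i ^ 2)
        * square_prod n (i - 1) ^ 2 * ratio_sum i"
      by (simp add: I_def i)
  qed
  finally show ?thesis .
qed

section \<open>Bernoulli polynomials\<close>

text \<open>The defining recursion in umbral form, \<open>(B + 1)^n = B^n\<close> apart from
  \<open>n = 1\<close>, where \<open>B_1 = -1/2\<close> forces the correction.\<close>

lemma sum_choose_bernoulli:
  "(\<Sum>k\<le>n. of_nat (n choose k) * bernoulli_num k) = bernoulli_num n + (if n = 1 then 1 else 0)"
proof -
  consider "n = 0" | "n = 1" | m where "n = Suc m" "m > 0" by (cases n) auto
  then show ?thesis
  proof cases
    case (3 m)
    have "bernoulli_num m = - (\<Sum>k<m. of_nat (Suc m choose k) * bernoulli_num k) / of_nat (Suc m)"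
      using \<open>m > 0\<close> by (subst bernoulli_num.simps) simp
    then have "of_nat (Suc m) * bernoulli_num m = - (\<Sum>k<m. of_nat (Suc m choose k) * bernoulli_num k)"
      by (simp add: field_simps del: of_nat_Suc binomial_Suc_Suc)
    then have "(\<Sum>k<Suc m. of_nat (Suc m choose k) * bernoulli_num k) = 0"
      by simp
    then show ?thesis using 3 by (simp add: lessThan_Suc_atMost[symmetric])
  qed (simp_all add: bernoulli_num.simps[of 0])
qed

lemma bernoulli_poly_0: "bernoulli_poly n 0 = bernoulli_num n"
proof -
  have "bernoulli_poly n 0 = (\<Sum>k\<le>n. if k = n then bernoulli_num k else 0)"
    unfolding bernoulli_poly_def by (intro sum.cong) (auto simp: power_0_left)
  then show ?thesis by simp
qed

text \<open>Expanding \<open>(x + 1)^(n-k)\<close> and collecting by \<open>m = k + i\<close> leaves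
  the inner sums of \<open>sum_choose_bernoulli\<close>; their exceptional value at
  \<open>m = 1\<close> produces \<open>n x^(n-1)\<close>.\<close>

lemma bernoulli_poly_add_1: "bernoulli_poly n (x + 1) = bernoulli_poly n x + of_nat n * x ^ (n - 1)"
proof -
  define g where "g = (\<lambda>k i. of_nat (n choose k) * of_nat ((n - k) choose i) * bernoulli_num k
      * x ^ (n - k - i))"
  have "bernoulli_poly n (x + 1) = (\<Sum>k\<le>n. \<Sum>i\<le>n-k. g k i)"
    unfolding bernoulli_poly_def g_def
    by (intro sum.cong refl, subst add.commute, subst binomial_ring)
      (simp add: sum_distrib_left mult_ac)
  also have "\<dots> = (\<Sum>(k, i)\<in>{(k, i). k + i \<le> n}. g k i)"
    by (subst sum.Sigma) (auto intro!: sum.cong)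
  also have "\<dots> = (\<Sum>m\<le>n. \<Sum>k\<le>m. g k (m - k))"
    by (rule sum.triangle_reindex_eq)
  also have "\<dots> = (\<Sum>m\<le>n. of_nat (n choose m) * x ^ (n - m)
      * (\<Sum>k\<le>m. of_nat (m choose k) * bernoulli_num k))"
  proof (intro sum.cong refl, unfold sum_distrib_left, intro sum.cong refl)
    fix m k assume "m \<in> {..n}" "k \<in> {..m}"
    then have "(n choose m) * (m choose k) = (n choose k) * ((n - k) choose (m - k))"
      by (intro choose_mult) auto
    then have "of_nat (n choose k) * of_nat ((n - k) choose (m - k))
        = (of_nat (n choose m) * of_nat (m choose k) :: rat)"
      by (simp only: of_nat_mult[symmetric])
    then show "g k (m - k) = of_nat (n choose m) * x ^ (n - m) * (of_nat (m choose k) * bernoulli_num k)"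
      using \<open>k \<in> {..m}\<close> by (simp add: g_def mult_ac)
  qed
  also have "\<dots> = bernoulli_poly n x + (\<Sum>m\<le>n. if m = 1 then of_nat (n choose m) * x ^ (n - m) else 0)"
    unfolding sum_choose_bernoulli bernoulli_poly_def sum.distrib[symmetric]
    by (intro sum.cong refl) (simp add: algebra_simps)
  also have "(\<Sum>m\<le>n. if m = 1 then of_nat (n choose m) * x ^ (n - m) else 0) = of_nat n * x ^ (n - 1)"
    by (cases n) simp_all
  finally show ?thesis .
qed

lemma sum_powers_bernoulli:
  "(\<Sum>k<m. of_nat n * of_nat k ^ (n - 1)) = bernoulli_poly n (of_nat m) - bernoulli_num n"
proof (induction m)
  case (Suc m)
  then show ?case using bernoulli_poly_add_1[of n "of_nat m"] by (simp add: add.commute)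
qed (simp add: bernoulli_poly_0)

text \<open>The system is triangular: the relation for \<open>n + 1\<close> has the last term
  \<open>(n + 1) * d n\<close>.\<close>

lemma zero_if_binomial_sums_zero:
  fixes d :: "nat \<Rightarrow> rat"
  assumes "\<And>n. n \<ge> 1 \<Longrightarrow> (\<Sum>k<n. of_nat (n choose k) * d k) = 0"
  shows "d n = 0"
proof (induction n rule: less_induct)
  case (less n)
  have "(\<Sum>k<n. of_nat (Suc n choose k) * d k) = 0" using less by (intro sum.neutral) simp
  then show ?case using assms[of "Suc n"] by (simp del: binomial_Suc_Suc of_nat_Suc)
qed

text \<open>Let \<open>d\<close> be the difference of the two sides. Evaluating
  \<open>bernoulli_poly n (-1)\<close> by the difference equation shows that the binomial transform
  of \<open>d\<close> is \<open>d\<close> itself, and this forces \<open>d = 0\<close>.\<close>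

lemma bernoulli_reflect: "(-1) ^ n * bernoulli_num n = bernoulli_num n + (if n = 1 then 1 else 0)"
proof -
  define d where "d = (\<lambda>k. (-1) ^ k * bernoulli_num k - (if k = 1 then 1 else 0) - bernoulli_num k)"
  have "d n = 0"
  proof (rule zero_if_binomial_sums_zero)
    fix n :: nat assume "n \<ge> 1"
    have "(\<Sum>k\<le>n. of_nat (n choose k) * ((-1) ^ k * bernoulli_num k)) = (-1) ^ n * bernoulli_poly n (-1)"
      unfolding bernoulli_poly_def sum_distrib_left
    proof (intro sum.cong refl)
      fix k assume "k \<in> {..n}"
      then have "(-1 :: rat) ^ n * (-1) ^ (n - k) = (-1) ^ k"
        by (metis atMost_iff le_add_diff_inverse2 left_minus_one_mult_self mult.commute power_add)
      then show "of_nat (n choose k) * ((-1) ^ k * bernoulli_num k)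
          = (-1) ^ n * (of_nat (n choose k) * bernoulli_num k * (-1) ^ (n - k))"
        by (metis (no_types, opaque_lifting) mult.assoc mult.commute)
    qed
    also have "bernoulli_poly n (-1) = bernoulli_num n + of_nat n * (-1) ^ n"
      using bernoulli_poly_add_1[of n "-1"] \<open>n \<ge> 1\<close> by (cases n) (simp_all add: bernoulli_poly_0)
    finally have 1: "(\<Sum>k\<le>n. of_nat (n choose k) * ((-1) ^ k * bernoulli_num k))
        = (-1) ^ n * bernoulli_num n + of_nat n"
      by (simp add: algebra_simps flip: power_add)
    have "(\<Sum>k\<le>n. of_nat (n choose k) * (if k = 1 then 1 else 0))
        = (\<Sum>k\<le>n. if k = 1 then of_nat (n choose k) else (0::rat))"
      by (intro sum.cong) auto
    also have "\<dots> = of_nat n" using \<open>n \<ge> 1\<close> by simp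
    \<comment> \<open>The term \<open>n\<close> from \<open>bernoulli_poly n (-1)\<close> cancels
      against the binomial transform of the indicator of 1.\<close>
    finally have "(\<Sum>k\<le>n. of_nat (n choose k) * d k) = d n"
      using 1 sum_choose_bernoulli[of n] unfolding d_def right_diff_distrib sum_subtractf by simp
    then show "(\<Sum>k<n. of_nat (n choose k) * d k) = 0"
      by (simp add: lessThan_Suc_atMost[symmetric])
  qed
  then show ?thesis by (simp add: d_def)
qed

lemma bernoulli_odd: "odd n \<Longrightarrow> n \<noteq> 1 \<Longrightarrow> bernoulli_num n = 0"
  using bernoulli_reflect[of n] by simp

section \<open>Localization at a prime\<close>

locale prime_localization =
  fixes p :: nat
  assumes prime_p: "prime p"
begin

text \<open>The ideal \<open>p^m Z_(p)\<close> of the localization of the integers at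
  \<open>p\<close>, regarded inside the rationals; \<open>J 0\<close> is the ring itself. Congruence
  modulo \<open>p^m\<close> becomes membership of the difference, see
  \<open>rat_cong_iff_J\<close>.\<close>

definition J :: "nat \<Rightarrow> rat set" where
  "J m = {x. \<exists>a b :: int. coprime b (int p) \<and> x = of_nat p ^ m * (of_int a / of_int b)}"

lemma p_nonzero [simp]: "(of_nat p :: rat) \<noteq> 0"
  using prime_p by (auto dest: prime_gt_0_nat)

lemma p_pos [simp]: "p > 0"
  using prime_p by (rule prime_gt_0_nat)

lemma coprime_nonzero: "coprime b (int p) \<Longrightarrow> b \<noteq> 0"
  using prime_p by (auto dest: prime_gt_1_nat)

lemma JI: "coprime b (int p) \<Longrightarrow> x = of_nat p ^ m * (of_int a / of_int b) \<Longrightarrow> x \<in> J m"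
  unfolding J_def by blast

lemma JE:
  assumes "x \<in> J m"
  obtains a b :: int where "coprime b (int p)" "b \<noteq> 0" "x = of_nat p ^ m * (of_int a / of_int b)"
  using assms coprime_nonzero unfolding J_def by blast

lemma J_0 [simp, intro]: "0 \<in> J m"
  by (rule JI[of 1 _ _ 0]) auto

lemma J_of_int [simp, intro]: "of_int a \<in> J 0"
  by (rule JI[of 1 _ _ a]) auto

lemma J_of_nat [simp, intro]: "of_nat a \<in> J 0"
  using J_of_int[of "int a"] by simp

lemma J_1 [simp, intro]: "1 \<in> J 0"
  using J_of_int[of 1] by simp

lemma J_numeral [simp, intro]: "numeral n \<in> J 0"
  using J_of_int[of "numeral n"] by simp

lemma J_add [intro]:
  assumes "x \<in> J m" "y \<in> J m"
  shows "x + y \<in> J m"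
proof -
  obtain a b where x: "coprime b (int p)" "b \<noteq> 0" "x = of_nat p ^ m * (of_int a / of_int b)"
    using assms(1) by (rule JE)
  obtain c d where y: "coprime d (int p)" "d \<noteq> 0" "y = of_nat p ^ m * (of_int c / of_int d)"
    using assms(2) by (rule JE)
  show ?thesis
    by (rule JI[of "b * d" _ _ "a * d + c * b"]) (use x y in \<open>simp_all add: field_simps\<close>)
qed

lemma J_mult:
  assumes "x \<in> J m" "y \<in> J n"
  shows "x * y \<in> J (m + n)"
proof -
  obtain a b where x: "coprime b (int p)" "b \<noteq> 0" "x = of_nat p ^ m * (of_int a / of_int b)"
    using assms(1) by (rule JE)
  obtain c d where y: "coprime d (int p)" "d \<noteq> 0" "y = of_nat p ^ n * (of_int c / of_int d)"
    using assms(2) by (rule JE)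
  show ?thesis
    by (rule JI[of "b * d" _ _ "a * c"]) (use x y in \<open>simp_all add: power_add\<close>)
qed

lemma J_mult_left [intro]: "x \<in> J 0 \<Longrightarrow> y \<in> J m \<Longrightarrow> x * y \<in> J m"
  using J_mult[of x 0 y m] by simp

lemma J_mult_right [intro]: "x \<in> J m \<Longrightarrow> y \<in> J 0 \<Longrightarrow> x * y \<in> J m"
  using J_mult[of x m y 0] by simp

lemma J_uminus [intro]: "x \<in> J m \<Longrightarrow> - x \<in> J m"
  using J_mult_left[of "-1" x m] J_of_int[of "-1"] by simp

lemma J_diff [intro]: "x \<in> J m \<Longrightarrow> y \<in> J m \<Longrightarrow> x - y \<in> J m"
  using J_add[of x m "-y"] by auto

lemma J_sum [intro]: "(\<And>k. k \<in> A \<Longrightarrow> f k \<in> J m) \<Longrightarrow> sum f A \<in> J m"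
  by (induction A rule: infinite_finite_induct) auto

lemma J_power [intro]: "x \<in> J 0 \<Longrightarrow> x ^ n \<in> J 0"
  by (induction n) auto

lemma J_p_power [intro]: "of_nat p ^ m \<in> J m"
  by (rule JI[of 1 _ _ 1]) auto

lemma J_mono: "x \<in> J n \<Longrightarrow> m \<le> n \<Longrightarrow> x \<in> J m"
proof (erule JE)
  fix a b :: int
  assume *: "m \<le> n" "coprime b (int p)" "b \<noteq> 0" "x = of_nat p ^ n * (of_int a / of_int b)"
  show "x \<in> J m"
    by (rule JI[of b _ _ "int p ^ (n - m) * a"])
      (use * in \<open>simp_all add: power_add[symmetric] mult.assoc[symmetric]\<close>)
qed

lemma J_p_power_cancel:
  assumes "of_nat p ^ m * x \<in> J (m + n)" shows "x \<in> J n"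
proof -
  obtain a b where "coprime b (int p)" "of_nat p ^ m * x = of_nat p ^ (m + n) * (of_int a / of_int b)"
    using assms by (rule JE)
  then have "of_nat p ^ m * x = of_nat p ^ m * (of_nat p ^ n * (of_int a / of_int b))"
    by (simp add: power_add)
  then have "x = of_nat p ^ n * (of_int a / of_int b)"
    by (metis mult_cancel_left p_nonzero power_not_zero)
  then show ?thesis using \<open>coprime b (int p)\<close> by (rule JI[rotated])
qed

lemma J_inverse:
  assumes "\<not> p dvd k" shows "1 / of_nat k \<in> J 0"
proof (rule JI[of "int k" _ _ 1])
  show "coprime (int k) (int p)"
    using assms prime_p prime_imp_coprime[of p k] by (simp add: coprime_commute)
qed simp

lemma J_inverse_less: "0 < k \<Longrightarrow> k < p \<Longrightarrow> 1 / of_nat k \<in> J 0"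
  by (rule J_inverse) (auto dest: dvd_imp_le)

lemma J_inverse_square: "0 < k \<Longrightarrow> k < p \<Longrightarrow> 1 / of_nat k ^ 2 \<in> J 0"
  using J_power[OF J_inverse_less[of k], of 2] by (simp add: power_one_over)

text \<open>A reduced denominator divides the denominator of every other representation, so one
  representation with denominator coprime to \<open>p\<close> suffices.\<close>

lemma rat_cong_iff_J: "rat_cong a b (int p) m \<longleftrightarrow> a - b \<in> J m"
proof
  assume *: "rat_cong a b (int p) m"
  define q where "q = quotient_of ((a - b) / of_nat p ^ m)"
  have "(a - b) / of_nat p ^ m = of_int (fst q) / of_int (snd q)"
    by (rule quotient_of_div) (simp add: q_def)
  then have "a - b = of_nat p ^ m * (of_int (fst q) / of_int (snd q))"
    by (metis nonzero_mult_div_cancel_left p_nonzero power_not_zero times_divide_eq_right)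
  moreover have "coprime (snd q) (int p)"
    using * by (simp add: rat_cong_def q_def)
  ultimately show "a - b \<in> J m" by (intro JI)
next
  assume "a - b \<in> J m"
  then obtain c d where cd: "coprime d (int p)" "d \<noteq> 0" "a - b = of_nat p ^ m * (of_int c / of_int d)"
    by (rule JE)
  define q where "q = quotient_of ((a - b) / of_nat p ^ m)"
  have q: "(a - b) / of_nat p ^ m = of_int (fst q) / of_int (snd q)"
    by (rule quotient_of_div) (simp add: q_def)
  have q0: "snd q > 0" unfolding q_def by (rule quotient_of_denom_pos')
  have cop: "coprime (fst q) (snd q)" by (rule quotient_of_coprime) (simp add: q_def)
  have "of_int c / of_int d = (of_int (fst q) / of_int (snd q) :: rat)"
    using q cd(3) by simp
  then have "(of_int (c * snd q) :: rat) = of_int (fst q * d)"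
    using cd(2) q0 by (simp add: field_simps)
  then have "c * snd q = fst q * d" by (simp only: of_int_eq_iff)
  then have "snd q dvd d" using cop
    by (metis coprime_commute coprime_dvd_mult_right_iff dvd_triv_right)
  then have "coprime (snd q) (int p)" using cd(1) coprime_divisors dvd_refl by blast
  then show "rat_cong a b (int p) m" by (simp add: rat_cong_def q_def)
qed

text \<open>After removing the constant and linear terms, every monomial of the expanded product
  contains at least two of the \<open>z t\<close>.\<close>

lemma J_prod_one_plus:
  assumes "\<And>t. t \<in> A \<Longrightarrow> z t \<in> J a"
  shows "(\<Prod>t\<in>A. 1 + z t) - 1 - (\<Sum>t\<in>A. z t) \<in> J (a + a)"
  using assms
proof (induction A rule: infinite_finite_induct)
  case (insert t A)
  have IH: "(\<Prod>t\<in>A. 1 + z t) - 1 - (\<Sum>t\<in>A. z t) \<in> J (a + a)"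
    using insert by blast
  have zs: "z t \<in> J a" "(\<Sum>t\<in>A. z t) \<in> J a" using insert by auto
  then have "(1 + z t) \<in> J 0" using J_mono[of "z t" a 0] by auto
  then have "(1 + z t) * ((\<Prod>t\<in>A. 1 + z t) - 1 - (\<Sum>t\<in>A. z t)) + z t * (\<Sum>t\<in>A. z t) \<in> J (a + a)"
    using J_mult[OF zs] IH by blast
  then show ?case using insert by (simp add: algebra_simps)
qed auto

lemma J_inverse_fact: "n < p \<Longrightarrow> 1 / fact n \<in> J 0"
proof (induction n)
  case (Suc n)
  have "1 / of_nat (Suc n) * (1 / fact n) \<in> J 0"
    using Suc J_inverse_less[of "Suc n"] by (intro J_mult_left) auto
  then show ?case by simp
qed simp

text \<open>Below \<open>2 * p\<close> the only positive multiple of \<open>p\<close> is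
  \<open>p\<close> itself, so the factorial contains at most one factor \<open>p\<close>.\<close>

lemma J_p_div_fact: "n < 2 * p \<Longrightarrow> of_nat p / fact n \<in> J 0"
proof (induction n)
  case (Suc n)
  consider "Suc n < p" | "Suc n = p" | "p < Suc n" by linarith
  then show ?case
  proof cases
    case 1
    then show ?thesis using J_mult_left[OF J_of_nat[of p] J_inverse_fact[of "Suc n"]]
        by (simp del: fact_Suc)
  next
    case 2
    have "of_nat p / (fact (Suc n) :: rat) = 1 / fact n"
      using 2 by (metis fact_Suc mult_divide_mult_cancel_left_if mult.right_neutral p_nonzero
          of_nat_mult)
    then show ?thesis using J_inverse_fact[of n] 2 by (simp del: fact_Suc)
  next
    case 3
    have "\<not> p dvd Suc n"
    proof
      assume "p dvd Suc n"
      then obtain q where "Suc n = p * q" by blast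
      with 3 Suc.prems have "1 < q" "q < 2" by (auto simp: mult.commute)
      then show False by simp
    qed
    then have "1 / of_nat (Suc n) * (of_nat p / fact n) \<in> J 0"
      using Suc J_inverse[of "Suc n"] by (intro J_mult_left) auto
    then show ?thesis by (simp add: mult.commute)
  qed
qed simp

end

section \<open>Bernoulli numbers and sums of inverse squares modulo a prime greater than 3\<close>

locale prime_localization_gt3 = prime_localization +
  assumes p_gt_3: "p > 3"
begin

lemma odd_p: "odd p"
  using prime_odd_nat[OF prime_p] p_gt_3 by simp

lemma J_half_cancel: "2 * x \<in> J m \<Longrightarrow> x \<in> J m"
  using J_mult_left[of "1/2" "2 * x" m] J_inverse_less[of 2] p_gt_3 by simp

lemma p_mod_3: "p mod 3 = 1 \<or> p mod 3 = 2"
proof -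
  have "\<not> 3 dvd p"
    using prime_p p_gt_3 primes_dvd_imp_eq[of 3 p] by auto
  then show ?thesis by presburger
qed

lemma J_third: "1 / 3 \<in> J 0"
  using J_inverse_less[of 3] p_gt_3 by simp

text \<open>This removes the constant term from Faulhaber's formula for the exponent
  \<open>p - 3\<close>.\<close>

lemma bernoulli_p_minus_2: "bernoulli_num (p - 2) = 0"
  using odd_p p_gt_3 by (intro bernoulli_odd) auto

text \<open>The recursion for index \<open>k\<close> divides only by \<open>k + 1\<close>, which is
  less than \<open>p\<close>.\<close>

lemma J_bernoulli: "k < p - 1 \<Longrightarrow> bernoulli_num k \<in> J 0"
proof (induction k rule: less_induct)
  case (less k)
  show ?case
  proof (cases "k = 0")
    case False
    have "1 / of_nat (Suc k) \<in> J 0" using less.prems by (intro J_inverse_less) auto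
    moreover have "- (\<Sum>j<k. of_nat (Suc k choose j) * bernoulli_num j) \<in> J 0"
      using less by (intro J_uminus J_sum J_mult_left) auto
    moreover have "bernoulli_num k
        = 1 / of_nat (Suc k) * - (\<Sum>j<k. of_nat (Suc k choose j) * bernoulli_num j)"
      using False by (subst bernoulli_num.simps) simp
    ultimately show ?thesis by (simp only: J_mult_left)
  qed (simp add: bernoulli_num.simps[of 0])
qed

lemma J_power_diff: "x \<in> J 0 \<Longrightarrow> y \<in> J 0 \<Longrightarrow> x - y \<in> J m \<Longrightarrow> x ^ n - y ^ n \<in> J m"
proof (induction n)
  case (Suc n)
  have "x * (x ^ n - y ^ n) + (x - y) * y ^ n \<in> J m" using Suc by blast
  then show ?case by (simp add: algebra_simps)
qed simp

lemma J_bernoulli_poly_diff: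
  assumes "x \<in> J 0" "y \<in> J 0" "x - y \<in> J 1" "n < p - 1"
  shows "bernoulli_poly n x - bernoulli_poly n y \<in> J 1"
  unfolding bernoulli_poly_def sum_subtractf[symmetric] right_diff_distrib[symmetric]
  using assms by (intro J_sum J_mult_left J_power_diff J_of_nat J_bernoulli) auto

text \<open>Fermat's theorem divided by \<open>k^2\<close>; it turns inverse squares into powers
  that Faulhaber's formula can sum.\<close>

lemma J_fermat:
  assumes "0 < k" "k < p"
  shows "1 / of_nat k ^ 2 - of_nat k ^ (p - 3) \<in> J 1"
proof -
  have "\<not> p dvd k" using assms by (auto dest: dvd_imp_le)
  then have "[k ^ (p - 1) = 1] (mod p)" by (rule fermat_theorem[OF prime_p])
  then have "[int (k ^ (p - 1)) = int 1] (mod int p)" by (simp only: cong_int_iff)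
  then obtain q where q: "int (k ^ (p - 1)) - 1 = int p * q"
    by (auto simp: cong_iff_dvd_diff)
  then have "of_int (int (k ^ (p - 1)) - 1) = (of_int (int p * q) :: rat)" by (simp only:)
  then have "(of_nat k ^ (p - 1) - 1 :: rat) = of_nat p ^ 1 * of_int q" by simp
  then have "(of_nat k ^ (p - 1) - 1 :: rat) \<in> J 1" by (metis J_mult_right J_of_int J_p_power)
  then have "- (1 / of_nat k ^ 2 * (of_nat k ^ (p - 1) - 1)) \<in> J 1"
    using assms J_inverse_square by blast
  moreover have "(of_nat k ^ (p - 1) :: rat) = of_nat k ^ 2 * of_nat k ^ (p - 3)"
  proof -
    have "p - 1 = 2 + (p - 3)" using p_gt_3 by simp
    then show ?thesis by (simp only: power_add)
  qed
  moreover have "- (1 / x ^ 2 * (x ^ 2 * y - 1)) = 1 / x ^ 2 - y" if "x \<noteq> 0" for x y :: rat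
    using that by (simp add: right_diff_distrib)
  ultimately show ?thesis using assms by simp
qed

definition inverse_squares :: "nat \<Rightarrow> rat" where "inverse_squares n = (\<Sum>k=1..n. 1 / of_nat k ^ 2)"

text \<open>Fermat and Faulhaber give \<open>(p - 2)\<close> times the sum of \<open>1/k^2\<close>
  as \<open>bernoulli_poly (p - 2) (n + 1)\<close> modulo \<open>p\<close>, and \<open>p - 2\<close>
  is congruent to -2.\<close>

lemma J_inverse_squares_bernoulli:
  assumes "n < p"
  shows "2 * inverse_squares n + bernoulli_poly (p - 2) (of_nat n + 1) \<in> J 1"
proof -
  have "bernoulli_poly (p - 2) (of_nat n + 1) = (\<Sum>k<Suc n. of_nat (p - 2) * of_nat k ^ (p - 3))"
  proof -
    have "p - 2 - 1 = p - 3" by simp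
    then show ?thesis
      using sum_powers_bernoulli[of "p - 2" "Suc n"] bernoulli_p_minus_2 by (simp add: add.commute)
  qed
  also have "\<dots> = (\<Sum>k=1..n. of_nat (p - 2) * of_nat k ^ (p - 3))"
    using p_gt_3 by (simp add: lessThan_Suc_atMost atMost_atLeast0 sum.atLeast_Suc_atMost)
  finally have "2 * inverse_squares n + bernoulli_poly (p - 2) (of_nat n + 1)
     = (\<Sum>k=1..n. 2 * (1 / of_nat k ^ 2) + of_nat (p - 2) * of_nat k ^ (p - 3))"
    unfolding inverse_squares_def sum_distrib_left sum.distrib by simp
  also have "\<dots> = (\<Sum>k=1..n. of_nat p ^ 1 * (1 / of_nat k ^ 2)
      - of_nat (p - 2) * (1 / of_nat k ^ 2 - of_nat k ^ (p - 3)))"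
  proof (intro sum.cong refl)
    fix k
    have "of_nat p ^ 1 = of_nat (p - 2) + (2 :: rat)" using p_gt_3 by (simp add: of_nat_diff)
    then show "2 * (1 / of_nat k ^ 2) + of_nat (p - 2) * of_nat k ^ (p - 3)
      = of_nat p ^ 1 * (1 / of_nat k ^ 2)
          - of_nat (p - 2) * (1 / of_nat k ^ 2 - of_nat k ^ (p - 3) :: rat)"
      by (simp only: distrib_right right_diff_distrib)
  qed
  also have "\<dots> \<in> J 1"
    using assms by (intro J_sum J_diff J_mult_left J_mult_right J_fermat J_inverse_square J_p_power
        J_of_nat) auto
  finally show ?thesis .
qed

lemma J_inverse_squares_full: "inverse_squares (p - 1) \<in> J 1"
proof -
  have "2 * inverse_squares (p - 1) + bernoulli_poly (p - 2) (of_nat p) \<in> J 1"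
    using J_inverse_squares_bernoulli[of "p - 1"] p_gt_3 by (simp add: of_nat_diff)
  moreover have "bernoulli_poly (p - 2) (of_nat p) - bernoulli_poly (p - 2) 0 \<in> J 1"
    using p_gt_3 J_p_power[of 1] by (intro J_bernoulli_poly_diff) auto
  moreover have "bernoulli_poly (p - 2) 0 = 0"
    by (simp add: bernoulli_poly_0 bernoulli_p_minus_2)
  ultimately have "2 * inverse_squares (p - 1) \<in> J 1"
    using J_diff by fastforce
  then show ?thesis by (rule J_half_cancel)
qed

lemma J_inverse_square_reflect:
  assumes "0 < k" "k < p"
  shows "1 / of_nat (p - k) ^ 2 - 1 / of_nat k ^ 2 \<in> J 1"
proof -
  define a where "a = (of_nat k :: rat)"
  define b where "b = (of_nat (p - k) :: rat)"
  have ab: "a \<noteq> 0" "b \<noteq> 0" "a + b = of_nat p" using assms by (auto simp: a_def b_def of_nat_diff)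
  have "of_nat p ^ 1 * ((a - b) * ((1 / a ^ 2) * (1 / b ^ 2))) \<in> J 1"
    using assms unfolding a_def b_def
    by (intro J_mult_right J_p_power J_mult_left J_diff J_of_nat J_inverse_square) auto
  moreover have "of_nat p ^ 1 * ((a - b) * ((1 / a ^ 2) * (1 / b ^ 2))) = 1 / b ^ 2 - 1 / a ^ 2"
    unfolding ab(3)[symmetric] using ab(1,2) by (simp add: field_simps power2_eq_square)
  ultimately show ?thesis by (simp add: a_def b_def)
qed

text \<open>The terms \<open>1/(p-k)^2\<close> with \<open>k \<le> n\<close> agree with
  \<open>1/k^2\<close> modulo \<open>p\<close>, so the two sums together make up the full sum, which
  is 0 modulo \<open>p\<close>.\<close>

lemma J_inverse_squares_reflect: "n < p \<Longrightarrow> inverse_squares (p - 1 - n) + inverse_squares n \<in> J 1"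
proof (induction n)
  case 0
  then show ?case using J_inverse_squares_full by (simp add: inverse_squares_def)
next
  case (Suc n)
  have "p - 1 - n = Suc (p - 1 - Suc n)" using Suc.prems by simp
  then have "inverse_squares (p - 1 - n) = inverse_squares (p - 1 - Suc n) + 1 / of_nat (p - Suc n) ^ 2"
    using Suc.prems unfolding inverse_squares_def by (simp del: of_nat_Suc)
  then have "inverse_squares (p - 1 - Suc n) + inverse_squares (Suc n)
      = (inverse_squares (p - 1 - n) + inverse_squares n)
      - (1 / of_nat (p - Suc n) ^ 2 - 1 / of_nat (Suc n) ^ 2)"
    unfolding inverse_squares_def by simp
  then show ?case using Suc J_inverse_square_reflect[of "Suc n"] by (auto simp del: of_nat_Suc)
qed

text \<open>The index \<open>(p - 1)/2\<close> is fixed by the reflection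
  \<open>n -> p - 1 - n\<close>.\<close>

lemma J_inverse_squares_half: "inverse_squares ((p - 1) div 2) \<in> J 1"
proof -
  have "p - 1 - (p - 1) div 2 = (p - 1) div 2" using odd_p by (auto elim!: oddE)
  moreover have "(p - 1) div 2 < p" using p_gt_3 by linarith
  ultimately have "2 * inverse_squares ((p - 1) div 2) \<in> J 1"
    unfolding mult_2 using J_inverse_squares_reflect[of "(p - 1) div 2"] by (simp only:)
  then show ?thesis by (rule J_half_cancel)
qed

text \<open>The index \<open>n\<close> must make \<open>n + 1\<close> congruent to
  \<open>1/3\<close>. For \<open>p = 3N + 2\<close> this is \<open>n = N\<close>, as
  \<open>n + 1 = (p + 1)/3\<close>; for \<open>p = 3N + 1\<close> it is \<open>n = 2N\<close>, as
  \<open>n + 1 = (2p + 1)/3\<close>, and the reflection back to \<open>N\<close> supplies the sign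
  \<open>chi3 p\<close>.\<close>

lemma J_inverse_squares_third:
    "2 * inverse_squares (p div 3) - of_int (chi3 (int p)) * bernoulli_poly (p - 2) (1 / 3) \<in> J 1"
proof -
  define N where "N = p div 3"
  have B: "bernoulli_poly (p - 2) (of_nat n + 1) - bernoulli_poly (p - 2) (1 / 3) \<in> J 1"
    if "3 * (of_nat n + 1) = 1 + of_nat c * (of_nat p :: rat)" for n c
  proof (rule J_bernoulli_poly_diff)
    have "of_nat n + 1 - 1 / 3 = of_nat p ^ 1 * (1 / 3 * of_nat c :: rat)"
      using that by (simp add: field_simps)
    then show "of_nat n + 1 - 1 / 3 \<in> J 1"
      using J_third by (simp only:) blast
  qed (use p_gt_3 J_third in auto)
  show ?thesis
  proof (cases "p mod 3 = 1")
    case True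
    then have p: "p = 3 * N + 1" unfolding N_def by presburger
    have "3 * (of_nat (2 * N) + 1) = 1 + of_nat 2 * (of_nat p :: rat)"
      unfolding p by simp
    note B = B[OF this]
    have chi3: "chi3 (int p) = 1" unfolding p chi3_def by simp
    have *: "2 * inverse_squares (2 * N) + bernoulli_poly (p - 2) (of_nat (2 * N) + 1) \<in> J 1"
      using p by (intro J_inverse_squares_bernoulli) simp
    have "p - 1 - N = 2 * N" using p by simp
    then have H: "inverse_squares (2 * N) + inverse_squares N \<in> J 1"
        using J_inverse_squares_reflect[of N] p by simp
    have "2 * (inverse_squares (2 * N) + inverse_squares N)
        - (2 * inverse_squares (2 * N) + bernoulli_poly (p - 2) (of_nat (2 * N) + 1))
       + (bernoulli_poly (p - 2) (of_nat (2 * N) + 1) - bernoulli_poly (p - 2) (1 / 3)) \<in> J 1"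
      by (rule J_add[OF J_diff[OF J_mult_left[OF J_numeral H] *] B])
    then show ?thesis by (simp add: chi3 N_def algebra_simps)
  next
    case False
    then have p: "p = 3 * N + 2" using p_mod_3 unfolding N_def by presburger
    have "3 * (of_nat N + 1) = 1 + of_nat 1 * (of_nat p :: rat)"
      unfolding p by simp
    note B = B[OF this]
    have chi3: "chi3 (int p) = -1" unfolding p chi3_def by simp
    have *: "2 * inverse_squares N + bernoulli_poly (p - 2) (of_nat N + 1) \<in> J 1"
      using p by (intro J_inverse_squares_bernoulli) simp
    have "(2 * inverse_squares N + bernoulli_poly (p - 2) (of_nat N + 1))
       - (bernoulli_poly (p - 2) (of_nat N + 1) - bernoulli_poly (p - 2) (1 / 3)) \<in> J 1"
      by (rule J_diff[OF * B])
    then show ?thesis by (simp add: chi3 N_def)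
  qed
qed

section \<open>The alternating character sum of inverse squares\<close>

definition signed_chi :: "nat \<Rightarrow> rat" where
  "signed_chi k = (-1) ^ Suc k * of_int (chi3 (int k))"

lemma J_minus_one_power [simp, intro]: "(-1) ^ k \<in> J 0"
  by (intro J_power J_uminus J_1)

lemma J_signed_chi [simp, intro]: "signed_chi k \<in> J 0"
  unfolding signed_chi_def by (intro J_mult_left J_of_int J_minus_one_power)

lemma J_sum_reflect:
  assumes "\<And>k. f k \<in> J 0"
  shows "(\<Sum>k=1..p-1. f k * (1 / of_nat k ^ 2)) - (\<Sum>k=1..p-1. f (p - k) * (1 / of_nat k ^ 2)) \<in> J 1"
proof -
  have "(\<Sum>k=1..p-1. f (p - k) * (1 / of_nat k ^ 2)) = (\<Sum>k=1..p-1. f k * (1 / of_nat (p - k) ^ 2))"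
    by (rule sum.reindex_bij_witness[of _ "\<lambda>k. p - k" "\<lambda>k. p - k"]) auto
  then have "(\<Sum>k=1..p-1. f k * (1 / of_nat k ^ 2)) - (\<Sum>k=1..p-1. f (p - k) * (1 / of_nat k ^ 2))
     = (\<Sum>k=1..p-1. f k * - (1 / of_nat (p - k) ^ 2 - 1 / of_nat k ^ 2))"
    by (simp add: right_diff_distrib sum_subtractf)
  also have "\<dots> \<in> J 1"
    using assms p_gt_3 by (intro J_sum J_mult_left J_uminus J_inverse_square_reflect) auto
  finally show ?thesis .
qed

lemma J_quarter: "1 / 4 \<in> J 0"
  using J_half_cancel[of "1 / 4" 0] J_half_cancel[of "1 / 2" 0] by simp

text \<open>An odd \<open>j \<le> N\<close>, where \<open>N = p div 3\<close>, is
  \<open>p - 2i\<close> with \<open>N < i \<le> M\<close>, where \<open>M = (p - 1)/2\<close>; the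
  lower limit is the same for both residues of \<open>p\<close> modulo 3. Since
  \<open>1/(p-2i)^2\<close> is congruent to \<open>1/(4 i^2)\<close>, the sum is a quarter of
  \<open>inverse_squares M - inverse_squares N\<close>, and the first of these is 0 modulo
  \<open>p\<close>.\<close>

lemma J_odd_inverse_squares_third:
  "(\<Sum>j\<in>{j\<in>{1..p div 3}. odd j}. 1 / of_nat j ^ 2) + 1 / 4 * inverse_squares (p div 3) \<in> J 1"
proof -
  define N where "N = p div 3"
  define M where "M = (p - 1) div 2"
  have pM: "p = 2 * M + 1" using odd_p unfolding M_def by (auto elim!: oddE)
  have pN: "p = 3 * N + 1 \<or> p = 3 * N + 2" using p_mod_3 unfolding N_def by presburger
  have NM: "N \<le> M" using pM pN by linarith
  have "(\<Sum>j\<in>{j\<in>{1..N}. odd j}. 1 / of_nat j ^ 2) = (\<Sum>i=N+1..M. 1 / (of_nat (p - 2 * i) ^ 2 :: rat))"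
  proof (rule sum.reindex_bij_witness[of _ "\<lambda>i. p - 2 * i" "\<lambda>j. (p - j) div 2"])
    fix j assume "j \<in> {j\<in>{1..N}. odd j}"
    then obtain l where l: "j = 2 * l + 1" "j \<le> N" by (auto elim: oddE)
    have "p - j = 2 * (M - l)" using l pM by simp
    then have half: "(p - j) div 2 = M - l" by simp
    have Ml: "N + 1 \<le> M - l" "l \<le> M" using l pM pN by linarith+
    show "p - 2 * ((p - j) div 2) = j" unfolding half using l pM Ml by simp
    then show "1 / of_nat (p - 2 * ((p - j) div 2)) ^ 2 = 1 / (of_nat j ^ 2 :: rat)" by simp
    show "(p - j) div 2 \<in> {N+1..M}" unfolding half using Ml by simp
  next
    fix i assume "i \<in> {N+1..M}"
    then have i: "N + 1 \<le> i" "i \<le> M" by simp_all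
    show "(p - (p - 2 * i)) div 2 = i" using i pM by simp
    have "p - 2 * i = 2 * (M - i) + 1" "p - 2 * i \<le> N" using i pM pN by linarith+
    then show "p - 2 * i \<in> {j\<in>{1..N}. odd j}" by simp
  qed
  also have "\<dots> = (\<Sum>i=N+1..M. (1 / of_nat (p - 2 * i) ^ 2 - 1 / of_nat (2 * i) ^ 2)
      + 1 / 4 * (1 / of_nat i ^ 2))"
    by (simp add: power_mult_distrib)
  also have "\<dots> = (\<Sum>i=N+1..M. 1 / of_nat (p - 2 * i) ^ 2 - 1 / of_nat (2 * i) ^ 2)
      + 1 / 4 * (inverse_squares M - inverse_squares N)"
  proof -
    have "inverse_squares M = inverse_squares N + (\<Sum>i=N+1..M. 1 / of_nat i ^ 2)"
      unfolding inverse_squares_def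
          using NM sum.ub_add_nat[of 1 N "\<lambda>i. 1 / (of_nat i ^ 2 :: rat)" "M - N"] by simp
    then have "inverse_squares M - inverse_squares N = (\<Sum>i=N+1..M. 1 / of_nat i ^ 2)" by simp
    then show ?thesis by (simp only: sum_distrib_left sum.distrib)
  qed
  finally have "(\<Sum>j\<in>{j\<in>{1..N}. odd j}. 1 / of_nat j ^ 2) + 1 / 4 * inverse_squares N
    = (\<Sum>i=N+1..M. 1 / of_nat (p - 2 * i) ^ 2 - 1 / of_nat (2 * i) ^ 2) + 1 / 4 * inverse_squares M"
    by (simp only: right_diff_distrib add.assoc diff_add_cancel)
  moreover have "(\<Sum>i=N+1..M. 1 / of_nat (p - 2 * i) ^ 2 - 1 / of_nat (2 * i) ^ 2) \<in> J 1"
    using pM by (intro J_sum J_inverse_square_reflect) auto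
  moreover have "1 / 4 * inverse_squares M \<in> J 1"
  proof (rule J_mult_left)
    show "1 / 4 \<in> J 0" by (rule J_quarter)
    show "inverse_squares M \<in> J 1" using J_inverse_squares_half by (simp add: M_def)
  qed
  ultimately show ?thesis unfolding N_def[symmetric] by (simp only: J_add)
qed

definition signed_third :: "nat \<Rightarrow> rat" where
  "signed_third k = (if 3 dvd k then (-1) ^ k else 0)"

lemma J_signed_third [simp, intro]: "signed_third k \<in> J 0"
  by (simp add: signed_third_def)

text \<open>As \<open>p\<close> is odd, the signs at \<open>k\<close> and \<open>p - k\<close> are
  opposite. If 3 divides neither \<open>k\<close> nor \<open>p - k\<close>, then
  \<open>p - k\<close> is congruent to \<open>k\<close> modulo 3 and the two terms cancel; only
  multiples of 3 remain.\<close>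

lemma signed_chi_add_reflect:
  assumes "k \<le> p"
  shows "signed_chi k + signed_chi (p - k)
      = of_int (chi3 (int p)) * (signed_third k + signed_third (p - k))"
proof -
  have s: "(-1 :: rat) ^ (p - k) = - ((-1) ^ k)"
    using assms odd_p by (cases "even k") auto
  have e: "signed_chi (p - k) = (-1) ^ k * of_int (chi3 (int p - int k))"
    unfolding signed_chi_def using s assms by (simp add: of_nat_diff)
  have d: "signed_third (p - k) = - ((-1) ^ k * of_bool (3 dvd int p - int k))"
    unfolding signed_third_def using s assms int_dvd_int_iff[of 3 "p - k"] by (simp add: of_nat_diff)
  have "int p mod 3 = 1 \<or> int p mod 3 = 2" using p_mod_3 by presburger
  then obtain P where P: "int p mod 3 = P" "P = 1 \<or> P = 2" by blast
  obtain K where K: "int k mod 3 = K" "K \<in> {0, 1, 2}" using mod_3_cases by blast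
  have m: "(int p - int k) mod 3 = (P - K) mod 3"
    unfolding P(1)[symmetric] K(1)[symmetric] by (simp add: mod_diff_eq)
  have "- chi3 (int k) + chi3 (int p - int k)
      = chi3 (int p) * (of_bool (3 dvd int k) - of_bool (3 dvd int p - int k))"
  proof -
    have "K = 0 \<or> K = 1 \<or> K = 2" using K(2) by simp
    with P(2) show ?thesis unfolding chi3_def dvd_eq_mod_eq_0 m P(1) K(1) by (elim disjE) simp_all
  qed
  then have "of_int (- chi3 (int k) + chi3 (int p - int k))
      = (of_int (chi3 (int p) * (of_bool (3 dvd int k) - of_bool (3 dvd int p - int k))) :: rat)"
    by (simp only:)
  then have *: "- of_int (chi3 (int k)) + of_int (chi3 (int p - int k))
      = (of_int (chi3 (int p)) * (of_bool (3 dvd int k) - of_bool (3 dvd int p - int k)) :: rat)"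
    by simp
  have "signed_chi k + signed_chi (p - k)
      = (-1) ^ k * (- of_int (chi3 (int k)) + of_int (chi3 (int p - int k)))"
    unfolding e by (simp add: signed_chi_def algebra_simps)
  also have "\<dots> = of_int (chi3 (int p)) * ((-1) ^ k * of_bool (3 dvd int k) + signed_third (p - k))"
    unfolding * d by (simp add: algebra_simps)
  also have "(-1) ^ k * of_bool (3 dvd int k) = signed_third k"
    using int_dvd_int_iff[of 3 k] by (simp add: signed_third_def)
  finally show ?thesis .
qed

lemma sum_signed_third: "(\<Sum>k=1..p-1. signed_third k * (1 / of_nat k ^ 2))
    = 1 / 9 * (\<Sum>j=1..p div 3. (-1) ^ j * (1 / of_nat j ^ 2))"
proof -
  have "(\<Sum>k=1..p-1. signed_third k * (1 / of_nat k ^ 2))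
      = (\<Sum>k\<in>(\<lambda>j. 3 * j) ` {1..p div 3}. signed_third k * (1 / of_nat k ^ 2))"
  proof (rule sum.mono_neutral_right)
    show "(\<lambda>j. 3 * j) ` {1..p div 3} \<subseteq> {1..p - 1}"
    proof
      fix k assume "k \<in> (\<lambda>j. 3 * j) ` {1..p div 3}"
      then obtain j where "k = 3 * j" "1 \<le> j" "j \<le> p div 3" by auto
      moreover have "3 * (p div 3) < p" using p_mod_3 mult_div_mod_eq[of 3 p] by linarith
      ultimately show "k \<in> {1..p - 1}" by auto
    qed
    show "\<forall>k\<in>{1..p - 1} - (\<lambda>j. 3 * j) ` {1..p div 3}. signed_third k * (1 / of_nat k ^ 2) = 0"
    proof
      fix k assume k: "k \<in> {1..p - 1} - (\<lambda>j. 3 * j) ` {1..p div 3}"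
      have "\<not> 3 dvd k"
      proof
        assume "3 dvd k"
        then obtain j where "k = 3 * j" by blast
        then show False using k by auto
      qed
      then show "signed_third k * (1 / of_nat k ^ 2) = 0" by (simp add: signed_third_def)
    qed
  qed simp
  also have "\<dots> = (\<Sum>j=1..p div 3. signed_third (3 * j) * (1 / of_nat (3 * j) ^ 2))"
    by (subst sum.reindex) (auto simp: inj_on_def)
  also have "\<dots> = 1 / 9 * (\<Sum>j=1..p div 3. (-1) ^ j * (1 / of_nat j ^ 2))"
    unfolding sum_distrib_left
    by (intro sum.cong refl) (simp add: signed_third_def power_mult power_mult_distrib)
  finally show ?thesis .
qed

definition chi_sum2 :: rat where "chi_sum2 = (\<Sum>k=1..p-1. signed_chi k * (1 / of_nat k ^ 2))"

text \<open>Modulo \<open>p\<close>, reflection gives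
  \<open>2 chi_sum2 = 2 c Ds = (2/9) c G\<close>. Here \<open>G = h - 2 O'\<close> equals
  \<open>(3/2) h\<close>, so \<open>chi_sum2 = c h / 6\<close>; finally \<open>2 h = c b\<close> and
  \<open>c^2 = 1\<close> yield \<open>b / 12\<close>.\<close>

lemma J_chi_sum2: "chi_sum2 - bernoulli_poly (p - 2) (1 / 3) / 12 \<in> J 1"
proof -
  define c where "c = (of_int (chi3 (int p)) :: rat)"
  define G where "G = (\<Sum>j=1..p div 3. (-1) ^ j * (1 / (of_nat j ^ 2 :: rat)))"
  define Ds where "Ds = (\<Sum>k=1..p-1. signed_third k * (1 / of_nat k ^ 2))"
  define Dr where "Dr = (\<Sum>k=1..p-1. signed_third (p - k) * (1 / of_nat k ^ 2))"
  define Ur where "Ur = (\<Sum>k=1..p-1. signed_chi (p - k) * (1 / of_nat k ^ 2))"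
  define O' where "O' = (\<Sum>j\<in>{j\<in>{1..p div 3}. odd j}. 1 / (of_nat j ^ 2 :: rat))"
  define h where "h = inverse_squares (p div 3)"
  define b where "b = bernoulli_poly (p - 2) (1 / 3)"
  have c2: "c * c = 1" and cJ: "c \<in> J 0"
  proof -
    have "int p mod 3 = 1 \<or> int p mod 3 = 2" using p_mod_3 by presburger
    then show "c * c = 1" by (auto simp: c_def chi3_def)
  qed (simp add: c_def)
  have 1: "chi_sum2 - Ur \<in> J 1" unfolding chi_sum2_def Ur_def by (rule J_sum_reflect) simp
  have 2: "Ds - Dr \<in> J 1" unfolding Ds_def Dr_def by (rule J_sum_reflect) simp
  have 3: "chi_sum2 + Ur = c * (Ds + Dr)"
    unfolding chi_sum2_def Ur_def Ds_def Dr_def c_def sum.distrib[symmetric] sum_distrib_left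
  proof (rule sum.cong)
    fix k assume "k \<in> {1..p-1}"
    then have "signed_chi k + signed_chi (p - k)
        = of_int (chi3 (int p)) * (signed_third k + signed_third (p - k))"
      by (intro signed_chi_add_reflect) auto
    then show "signed_chi k * (1 / of_nat k ^ 2) + signed_chi (p - k) * (1 / of_nat k ^ 2)
        = of_int (chi3 (int p))
            * (signed_third k * (1 / of_nat k ^ 2) + signed_third (p - k) * (1 / of_nat k ^ 2))"
      by (simp only: distrib_right[symmetric] mult.assoc)
  qed simp
  have 4: "Ds = 1 / 9 * G" unfolding Ds_def G_def by (rule sum_signed_third)
  have 5: "G = h - 2 * O'"
  proof -
    have "2 * O' = (\<Sum>j=1..p div 3. if odd j then 2 * (1 / (of_nat j ^ 2)) else 0)"
      unfolding O'_def sum_distrib_left by (rule sum.inter_filter) simp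
    then have "h - 2 * O'
        = (\<Sum>j=1..p div 3. 1 / of_nat j ^ 2 - (if odd j then 2 * (1 / (of_nat j ^ 2)) else 0))"
      unfolding h_def inverse_squares_def by (simp only: sum_subtractf)
    also have "\<dots> = G" unfolding G_def by (intro sum.cong refl) auto
    finally show ?thesis ..
  qed
  have 6: "O' + 1 / 4 * h \<in> J 1" unfolding O'_def h_def by (rule J_odd_inverse_squares_third)
  have 7: "2 * h - c * b \<in> J 1" unfolding h_def c_def b_def by (rule J_inverse_squares_third)
  have n: "1 / 9 \<in> J 0" "1 / 12 \<in> J 0"
    using J_mult_left[OF J_third J_third] J_mult_left[OF J_third J_quarter] by auto
  \<comment> \<open>The multipliers are chosen so that \<open>Ur\<close>, \<open>Ds\<close>,
    \<open>Dr\<close>, \<open>O'\<close> and \<open>h\<close> all drop out with the help of the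
    exact relations 3, 4 and 5.\<close>
  have "(chi_sum2 - Ur) - c * (Ds - Dr) - c * (2 * (2 * (1 / 9 * (O' + 1 / 4 * h))))
      + c * (2 * (1 / 12 * (2 * h - c * b))) \<in> J 1"
    by (rule J_add[OF J_diff[OF J_diff[OF 1 J_mult_left[OF cJ 2]]
        J_mult_left[OF cJ J_mult_left[OF J_numeral J_mult_left[OF J_numeral J_mult_left[OF n(1) 6]]]]]
        J_mult_left[OF cJ J_mult_left[OF J_numeral J_mult_left[OF n(2) 7]]]])
  moreover have "(chi_sum2 - Ur) - c * (Ds - Dr) - c * (2 * (2 * (1 / 9 * (O' + 1 / 4 * h))))
      + c * (2 * (1 / 12 * (2 * h - c * b)))
     = 2 * chi_sum2 - (chi_sum2 + Ur - c * (Ds + Dr)) - 2 * c * (Ds - 1 / 9 * G)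
         - 2 / 9 * c * (G - h + 2 * O') - 1 / 6 * (c * c) * b"
    by (simp add: field_simps)
  moreover have "chi_sum2 + Ur - c * (Ds + Dr) = 0" "Ds - 1 / 9 * G = 0" "G - h + 2 * O' = 0"
    using 3 4 5 by simp_all
  ultimately have "2 * chi_sum2 - 1 / 6 * b \<in> J 1"
    using c2 by (simp only: mult_zero_right diff_0_right mult_1_right)
  then have "2 * (chi_sum2 - b / 12) \<in> J 1" by (simp add: algebra_simps)
  then show ?thesis unfolding b_def by (rule J_half_cancel)
qed

end

section \<open>Expansion of binomial coefficients in powers of p\<close>

lemma choose_pred_prod: "of_nat (n choose k)
    = ((-1) ^ k * (\<Prod>t=1..k. 1 + - (of_nat (Suc n) / of_nat t)) :: rat)"
proof (induction k)
  case (Suc k)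
  have "of_nat (n choose Suc k) = (of_nat n - of_nat k) / of_nat (Suc k) * (of_nat (n choose k) :: rat)"
    using choose_Suc_rat[of k n] by (simp add: field_simps del: of_nat_Suc)
  also have "(of_nat n - of_nat k) / of_nat (Suc k)
      = - (1 + - (of_nat (Suc n) / (of_nat (Suc k) :: rat)))"
    by (simp add: field_simps)
  also have "- (1 + - (of_nat (Suc n) / of_nat (Suc k))) * of_nat (n choose k)
      = ((-1) ^ Suc k * ((\<Prod>t=1..k. 1 + - (of_nat (Suc n) / of_nat t))
          * (1 + - (of_nat (Suc n) / of_nat (Suc k)))) :: rat)"
    unfolding Suc power_Suc by (simp only: mult_minus_left mult_minus_right mult_1_left mult_ac)
  finally show ?case by simp
qed simp

lemma choose_add_prod: "of_nat ((n + k) choose k) = ((\<Prod>t=1..k. 1 + of_nat n / of_nat t) :: rat)"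
proof (induction k)
  case (Suc k)
  have "of_nat (Suc k) * (of_nat ((n + Suc k) choose Suc k) :: rat)
      = of_nat (Suc (n + k)) * of_nat ((n + k) choose k)"
    by (simp only: add_Suc_right of_nat_mult[symmetric] Suc_times_binomial)
  then have "of_nat ((n + Suc k) choose Suc k)
      = of_nat (Suc (n + k)) / of_nat (Suc k) * (of_nat ((n + k) choose k) :: rat)"
    by (simp add: eq_divide_eq mult.commute del: of_nat_Suc binomial_Suc_Suc add_Suc_right)
  also have "of_nat (Suc (n + k)) / of_nat (Suc k) = 1 + of_nat n / (of_nat (Suc k) :: rat)"
    by (simp add: field_simps)
  finally show ?case unfolding Suc by simp
qed simp

text \<open>This links the ratios in \<open>Y\<close> to \<open>binom(p,k)\<close>, for which the
  character sums are known exactly.\<close>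

lemma binom_ratio_choose:
  assumes "k \<le> n"
  shows "binom_ratio n k * of_nat ((n + k) choose k) = of_nat (n choose k)"
  using assms by (simp add: binom_ratio_fact binomial_fact power2_eq_square)

context prime_localization_gt3
begin

definition harmonic :: "nat \<Rightarrow> rat" where "harmonic k = (\<Sum>t=1..k. 1 / of_nat t)"

lemma J_harmonic: "k < p \<Longrightarrow> harmonic k \<in> J 0"
  unfolding harmonic_def by (intro J_sum J_inverse_less) auto

lemma J_choose_add:
  assumes "k < p"
  shows "of_nat ((p + k) choose k) - 1 - of_nat p * harmonic k \<in> J 2"
proof -
  have "of_nat p ^ 1 * (1 / of_nat t) \<in> J 1" if "t \<in> {1..k}" for t
    using that assms by (intro J_mult_right J_p_power J_inverse_less) auto
  from J_prod_one_plus[of "{1..k}", OF this] show ?thesis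
    by (simp add: choose_add_prod harmonic_def sum_distrib_left numeral_2_eq_2)
qed

lemma J_choose_pred:
  assumes "k < p"
  shows "of_nat ((p - 1) choose k) - (-1) ^ k * (1 - of_nat p * harmonic k) \<in> J 2"
proof -
  have "- (of_nat p ^ 1 * (1 / of_nat t)) \<in> J 1" if "t \<in> {1..k}" for t
    using that assms by (intro J_uminus J_mult_right J_p_power J_inverse_less) auto
  from J_mult_left[OF J_minus_one_power[of k] J_prod_one_plus[of "{1..k}", OF this]] show ?thesis
    using p_gt_3 by (simp add: choose_pred_prod harmonic_def sum_distrib_left sum_negf
        numeral_2_eq_2 algebra_simps)
qed

lemma J_choose_pred_weak:
  assumes "k < p"
  shows "of_nat ((p - 1) choose k) - (-1) ^ k \<in> J 1"
proof -
  have H: "of_nat p ^ 1 * harmonic k \<in> J 1" using assms J_harmonic by blast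
  have c: "of_nat ((p - 1) choose k) - (-1) ^ k * (1 - of_nat p * harmonic k) \<in> J 1"
    by (rule J_mono[OF J_choose_pred[OF assms]]) simp
  have "(of_nat ((p - 1) choose k) - (-1) ^ k * (1 - of_nat p * harmonic k))
      - (-1) ^ k * (of_nat p ^ 1 * harmonic k) \<in> J 1"
    by (rule J_diff[OF c J_mult_left[OF J_minus_one_power H]])
  then show ?thesis by (simp add: algebra_simps)
qed

lemma choose_p: "k \<ge> 1 \<Longrightarrow> of_nat (p choose k)
    = of_nat p * (1 / of_nat k * (of_nat ((p - 1) choose (k - 1)) :: rat))"
proof -
  assume "k \<ge> 1"
  then obtain l where l: "k = Suc l" by (cases k) auto
  obtain q where q: "p = Suc q" using p_pos gr0_conv_Suc by blast
  have "of_nat (Suc l) * (of_nat (Suc q choose Suc l) :: rat) = of_nat (Suc q) * of_nat (q choose l)"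
    by (simp only: of_nat_mult[symmetric] Suc_times_binomial)
  then show ?thesis unfolding l q
      by (simp add: eq_divide_eq mult.commute del: of_nat_Suc binomial_Suc_Suc)
qed

text \<open>The numerator \<open>p!^2\<close> contains \<open>p^2\<close>, while
  \<open>(p+k)!\<close> contains \<open>p\<close> only once and \<open>(p-k)!\<close> not at
  all.\<close>

lemma J_binom_ratio_p:
  assumes "1 \<le> k" "k < p"
  shows "binom_ratio p k \<in> J 1"
proof -
  have "binom_ratio p k = fact p ^ 2 / (fact (p - k) * fact (p + k))"
    using assms by (intro binom_ratio_fact) simp
  also have "fact p = of_nat p * (fact (p - 1) :: rat)"
    using p_pos by (simp add: fact_reduce)
  finally have "binom_ratio p k
      = of_nat p ^ 1 * (fact (p - 1) * (fact (p - 1) * (1 / fact (p - k) * (of_nat p / fact (p + k)))))"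
    by (simp add: power2_eq_square)
  moreover have "fact (p - 1) \<in> J 0" using J_of_nat[of "fact (p - 1)"] by simp
  moreover have "1 / fact (p - k) \<in> J 0" "of_nat p / fact (p + k) \<in> J 0"
    using assms by (auto intro!: J_inverse_fact J_p_div_fact)
  ultimately show ?thesis by (simp only: J_mult_right[OF J_p_power] J_mult_left)
qed

text \<open>The denominators contain \<open>(i+k)!\<close> with \<open>i + k < 2 * p\<close>, hence
  at most one factor \<open>p\<close>.\<close>

lemma J_p_ratio_sum:
  assumes "i < p"
  shows "of_nat p * ratio_sum i \<in> J 0"
proof -
  have "of_nat p * ratio_sum i
      = (\<Sum>k=1..i. of_int (chi3 (int k))
      * (fact i * (fact i * (1 / fact (i - k) * (of_nat p / fact (i + k))))))"
    unfolding ratio_sum_def sum_distrib_left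
    by (intro sum.cong refl) (simp add: binom_ratio_fact power2_eq_square mult_ac)
  also have "\<dots> \<in> J 0"
    using assms J_of_nat[of "fact i"]
    by (intro J_sum J_mult_left J_inverse_fact J_p_div_fact J_of_int) auto
  finally show ?thesis .
qed

lemma square_prod_p:
  defines "z \<equiv> \<lambda>t. - (of_nat p ^ 2 * (1 / of_nat t ^ 2)) :: rat"
  shows "square_prod p j = (-1) ^ j * (\<Prod>t=1..j. 1 + z t)"
proof -
  have "square_prod p j = (\<Prod>t=1..j. (-1) * (1 + z t))"
    unfolding square_prod_def by (intro prod.cong refl) (simp add: z_def field_simps)
  then show ?thesis by (simp only: prod.distrib prod_constant) simp
qed

lemma J_square_prod_aux:
  assumes "j < p"
  shows "(\<Prod>t=1..j. 1 + - (of_nat p ^ 2 * (1 / of_nat t ^ 2))) - 1 + of_nat p ^ 2 * inverse_squares j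
      \<in> J 4"
proof -
  have "- (of_nat p ^ 2 * (1 / of_nat t ^ 2)) \<in> J 2" if "t \<in> {1..j}" for t
    using that assms by (intro J_uminus J_mult_right J_p_power J_inverse_square) auto
  from J_prod_one_plus[of "{1..j}", OF this] show ?thesis
    by (simp add: inverse_squares_def sum_distrib_left sum_negf)
qed

lemma J_inverse_squares: "j < p \<Longrightarrow> inverse_squares j \<in> J 0"
  unfolding inverse_squares_def by (intro J_sum J_inverse_square) auto

text \<open>Squaring removes the sign \<open>(-1)^j\<close>, and the unsigned product is 1 modulo
  \<open>p^2\<close>.\<close>

lemma J_square_prod_square:
  assumes "j < p"
  shows "square_prod p j ^ 2 - 1 \<in> J 2"
proof -
  define Q where "Q = (\<Prod>t=1..j. 1 + - (of_nat p ^ 2 * (1 / of_nat t ^ 2)) :: rat)"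
  have "of_nat p ^ 2 * inverse_squares j \<in> J 2" using J_inverse_squares[OF assms] by blast
  then have "(Q - 1 + of_nat p ^ 2 * inverse_squares j) - of_nat p ^ 2 * inverse_squares j \<in> J 2"
    using J_mono[OF J_square_prod_aux[OF assms], of 2] unfolding Q_def by (intro J_diff) auto
  then have Q: "Q - 1 \<in> J 2" by simp
  then have "Q - 1 \<in> J 0" by (rule J_mono) simp
  then have "(Q - 1) * ((Q - 1) + 2) \<in> J 2" by (intro J_mult_right[OF Q] J_add J_numeral)
  moreover have "square_prod p j ^ 2 - 1 = (Q - 1) * ((Q - 1) + 2)"
    unfolding square_prod_p Q_def[symmetric]
        by (simp add: power_mult_distrib power2_eq_square algebra_simps flip: power_mult)
  ultimately show ?thesis by simp
qed

text \<open>Wolstenholme's theorem, by \<open>central_binom_eq_square_prod\<close>.\<close>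

lemma J_square_prod_p_minus_1: "square_prod p (p - 1) - 1 \<in> J 3"
proof -
  define Q where "Q = (\<Prod>t=1..p-1. 1 + - (of_nat p ^ 2 * (1 / of_nat t ^ 2)) :: rat)"
  have "of_nat p ^ 2 * inverse_squares (p - 1) \<in> J (2 + 1)" using J_inverse_squares_full
      by (intro J_mult J_p_power)
  then have "(Q - 1 + of_nat p ^ 2 * inverse_squares (p - 1))
      - of_nat p ^ 2 * inverse_squares (p - 1) \<in> J 3"
    using J_mono[OF J_square_prod_aux[of "p - 1"], of 3] p_gt_3 unfolding Q_def by (intro J_diff) auto
  then show ?thesis using odd_p unfolding square_prod_p Q_def[symmetric] by simp
qed

section \<open>Reduction of the Apery sum to \<open>Y\<close>, here called
  \<open>chi_ratio_sum\<close>\<close>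

definition chi_ratio_sum :: rat where "chi_ratio_sum
    = (\<Sum>k=1..p-1. of_int (chi3 (int k)) * binom_ratio p k)"

text \<open>After the second telescoping, \<open>binom_ratio_Suc\<close> turns
  \<open>p^2 binom_ratio (p-1) k / k^2 + binom_ratio p k\<close> into
  \<open>p^2 binom_ratio p k / k^2\<close>, and \<open>binom_ratio p k\<close> supplies the third
  factor \<open>p\<close>.\<close>

lemma J_p_square_ratio_sums:
  "of_nat p ^ 2 * (\<Sum>i=1..p-1. ratio_sum i / of_nat i ^ 2) + chi_ratio_sum \<in> J 3"
proof -
  obtain q where q: "p = Suc q" using p_pos gr0_conv_Suc by blast
  have "of_nat p ^ 2 * (\<Sum>i=1..p-1. ratio_sum i / of_nat i ^ 2) + chi_ratio_sum
     = (\<Sum>k=1..p-1. of_nat p ^ 2 * (of_int (chi3 (int k)) * binom_ratio (p - 1) k / of_nat k ^ 2)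
         + of_int (chi3 (int k)) * binom_ratio p k)"
    by (simp only: sum_ratio_sum sum_distrib_left chi_ratio_sum_def sum.distrib)
  also have "\<dots> = (\<Sum>k=1..p-1. of_nat p ^ 2
      * (binom_ratio p k * (of_int (chi3 (int k)) * (1 / of_nat k ^ 2))))"
  proof (intro sum.cong refl)
    fix k assume "k \<in> {1..p-1}"
    define x where "x = (of_nat k ^ 2 :: rat)"
    have x: "x \<noteq> 0" using \<open>k \<in> {1..p-1}\<close> by (simp add: x_def)
    have "of_nat p ^ 2 * binom_ratio (p - 1) k = binom_ratio p k * (of_nat p ^ 2 - x)"
      using binom_ratio_Suc[of q k] by (simp add: q x_def mult.commute)
    then have "of_nat p ^ 2 * (of_int (chi3 (int k)) * binom_ratio (p - 1) k / x)
      = of_int (chi3 (int k)) * (binom_ratio p k * (of_nat p ^ 2 - x)) / x"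
      by (metis (no_types, lifting) mult.left_commute times_divide_eq_right)
    then show "of_nat p ^ 2 * (of_int (chi3 (int k)) * binom_ratio (p - 1) k / of_nat k ^ 2)
        + of_int (chi3 (int k)) * binom_ratio p k
      = of_nat p ^ 2 * (binom_ratio p k * (of_int (chi3 (int k)) * (1 / of_nat k ^ 2)))"
      unfolding x_def[symmetric] using x by (simp add: field_simps)
  qed
  also have "\<dots> \<in> J (2 + 1)"
  proof (intro J_sum J_mult[OF J_p_power J_mult_right])
    fix k assume "k \<in> {1..p-1}"
    then have k: "1 \<le> k" "k < p" using p_pos by auto
    then show "binom_ratio p k \<in> J 1" by (rule J_binom_ratio_p)
    show "of_int (chi3 (int k)) * (1 / of_nat k ^ 2) \<in> J 0"
      using k by (intro J_mult_left J_of_int J_inverse_square) auto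
  qed
  finally show ?thesis by simp
qed

lemma sum_up_to_p: "(\<Sum>k=1..p. f k) = (\<Sum>k=1..p-1. f k) + (f p :: rat)"
  using p_pos by (cases p) simp_all

lemma central_binom_sum_p: "central_binom_sum p
    = of_int (chi3 (int p)) + central_binom p * chi_ratio_sum"
proof -
  have "ratio_sum p = chi_ratio_sum + of_int (chi3 (int p)) * binom_ratio p p"
    unfolding ratio_sum_def chi_ratio_sum_def by (rule sum_up_to_p)
  moreover have "binom_ratio p p = 1 / central_binom p" by (simp add: binom_ratio_def mult_2[symmetric])
  ultimately show ?thesis using central_binom_pos[of p]
      by (simp add: central_binom_sum_eq_ratio_sum algebra_simps)
qed

text \<open>Modulo \<open>p^3\<close>, \<open>w\<close> is 1 and \<open>S\<close> is
  \<open>3 X\<close>, that is \<open>-3 Y\<close>. Since \<open>central_binom_sum p\<close> equals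
  \<open>chi3 p + 2 w Y\<close>, the total is \<open>chi3 p + 2 Y - 3 Y\<close>.\<close>

lemma J_apery_sum:
  "(1 / of_nat p) * (\<Sum>k<p. (-1)^k * of_nat (2 * k + 1) * of_nat (apery k))
      - (of_int (chi3 (int p)) - chi_ratio_sum) \<in> J 3"
proof -
  define S where "S = (\<Sum>i=1..p-1. of_nat p ^ 2 / of_nat i ^ 2 * (3 - of_nat p ^ 2 / of_nat i ^ 2)
      * square_prod p (i - 1) ^ 2 * ratio_sum i)"
  define X where "X = of_nat p ^ 2 * (\<Sum>i=1..p-1. ratio_sum i / of_nat i ^ 2)"
  define w where "w = square_prod p (p - 1)"
  have p: "p = Suc (p - 1)" using p_pos by simp
  have sum: "(1 / of_nat p) * (\<Sum>k<p. (-1)^k * of_nat (2 * k + 1) * of_nat (apery k))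
      = w * central_binom_sum p + S"
    unfolding S_def w_def using odd_p p by (rule apery_sum_eq)
  \<comment> \<open>One factor of \<open>p^2\<close> clears the denominators of
    \<open>ratio_sum i\<close>; the other joins the two factors gained from the last
    bracket.\<close>
  have "S - 3 * X = (\<Sum>i=1..p-1. of_nat p ^ 1 * ((of_nat p * ratio_sum i) * (1 / of_nat i ^ 2) *
      (3 * (square_prod p (i - 1) ^ 2 - 1)
          - of_nat p ^ 2 * (1 / of_nat i ^ 2 * square_prod p (i - 1) ^ 2))))"
    unfolding S_def X_def sum_distrib_left sum_subtractf[symmetric]
    by (intro sum.cong refl) (simp add: algebra_simps power2_eq_square)
  also have "\<dots> \<in> J (1 + 2)"
  proof (intro J_sum J_mult[OF J_p_power J_mult_left])
    fix i assume "i \<in> {1..p-1}"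
    then have i: "0 < i" "i < p" "i - 1 < p" using p_pos by auto
    show "(of_nat p * ratio_sum i) * (1 / of_nat i ^ 2) \<in> J 0"
      using i J_p_ratio_sum J_inverse_square by blast
    have W: "square_prod p (i - 1) ^ 2 - 1 \<in> J 2" using i by (intro J_square_prod_square)
    then have "square_prod p (i - 1) ^ 2 - 1 \<in> J 0" by (rule J_mono) simp
    then have "(square_prod p (i - 1) ^ 2 - 1) + 1 \<in> J 0" by (intro J_add J_1)
    then have "1 / of_nat i ^ 2 * square_prod p (i - 1) ^ 2 \<in> J 0"
      using i by (intro J_mult_left J_inverse_square) auto
    then show "3 * (square_prod p (i - 1) ^ 2 - 1)
        - of_nat p ^ 2 * (1 / of_nat i ^ 2 * square_prod p (i - 1) ^ 2) \<in> J 2"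
      using W by (intro J_diff[OF J_mult_left[OF J_numeral] J_mult_right[OF J_p_power]])
  qed
  finally have 1: "S - 3 * X \<in> J 3" by (simp add: numeral_3_eq_3)
  have 2: "X + chi_ratio_sum \<in> J 3" unfolding X_def by (rule J_p_square_ratio_sums)
  have 3: "w - 1 \<in> J 3" unfolding w_def by (rule J_square_prod_p_minus_1)
  have central_binom: "central_binom p = 2 * w" using central_binom_eq_square_prod[of "p - 1"] p
      by (simp add: w_def)
  have 4: "central_binom_sum p \<in> J 0" unfolding central_binom_sum_def central_binom_def
      by (intro J_sum J_of_nat)
  have 5: "chi_ratio_sum \<in> J 0" unfolding chi_ratio_sum_def
  proof (intro J_sum J_mult_left J_of_int)
    fix k assume "k \<in> {1..p-1}"
    then have "binom_ratio p k \<in> J 1" using p_pos by (intro J_binom_ratio_p) auto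
    then show "binom_ratio p k \<in> J 0" by (rule J_mono) simp
  qed
  have "(w - 1) * central_binom_sum p + (S - 3 * X) + 3 * (X + chi_ratio_sum)
      + 2 * ((w - 1) * chi_ratio_sum) \<in> J 3"
    by (rule J_add[OF J_add[OF J_add[OF J_mult_right[OF 3 4] 1] J_mult_left[OF J_numeral 2]]
          J_mult_left[OF J_numeral J_mult_right[OF 3 5]]])
  moreover have "(w - 1) * central_binom_sum p + (S - 3 * X) + 3 * (X + chi_ratio_sum)
      + 2 * ((w - 1) * chi_ratio_sum)
     = (w * central_binom_sum p + S) - (central_binom_sum p - 2 * w * chi_ratio_sum - chi_ratio_sum)"
    by (simp add: algebra_simps)
  moreover have "central_binom_sum p - 2 * w * chi_ratio_sum - chi_ratio_sum
      = of_int (chi3 (int p)) - chi_ratio_sum"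
    unfolding central_binom_sum_p central_binom by simp
  ultimately show ?thesis unfolding sum by (simp only:)
qed

section \<open>Elimination of the harmonic numbers from \<open>Y\<close>\<close>

definition chi_harmonic_sum :: rat where "chi_harmonic_sum
    = (\<Sum>k=1..p-1. signed_chi k * (1 / of_nat k * harmonic k))"
definition chi_sum1 :: rat where "chi_sum1 = (\<Sum>k=1..p-1. signed_chi k * (1 / of_nat k))"

text \<open>For odd \<open>p\<close> the full sum up to \<open>p\<close> equals
  \<open>chi3 p\<close>, which is exactly its last term.\<close>

lemma sum_choose_p_chi: "(\<Sum>k=1..p-1. of_int (chi3 (int k)) * of_nat (p choose k)) = (0 :: rat)"
proof -
  have "(\<Sum>k=1..p. of_nat (p choose k) * of_int (chi3 (int k))) = (of_int (chi3 (int p)) :: rat)"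
    using sum_choose_chi_rat[of p] odd_p by simp
  moreover have "(\<Sum>k=1..p. of_nat (p choose k) * of_int (chi3 (int k)))
    = (\<Sum>k=1..p-1. of_int (chi3 (int k)) * of_nat (p choose k)) + (of_int (chi3 (int p)) :: rat)"
    unfolding sum_up_to_p by (simp add: mult.commute)
  ultimately show ?thesis by simp
qed

text \<open>Modulo \<open>p^3\<close>, \<open>binom_ratio p k\<close> is
  \<open>binom(p,k) (1 - p harmonic k)\<close>. The part without harmonic numbers sums to 0 exactly;
  in the rest, \<open>binom(p,k) = (p/k) binom(p-1,k-1)\<close> produces \<open>p^2\<close>, and the
  remaining binomial coefficient may be replaced by its sign.\<close>

lemma J_chi_ratio_harmonic: "chi_ratio_sum + of_nat p ^ 2 * chi_harmonic_sum \<in> J 3"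
proof -
  have "chi_ratio_sum + of_nat p ^ 2 * chi_harmonic_sum
      = (\<Sum>k=1..p-1. of_int (chi3 (int k)) * binom_ratio p k) + of_nat p ^ 2 * chi_harmonic_sum
     - (\<Sum>k=1..p-1. of_int (chi3 (int k)) * of_nat (p choose k))"
    unfolding sum_choose_p_chi chi_ratio_sum_def by simp
  also have "\<dots> = (\<Sum>k=1..p-1. of_int (chi3 (int k))
      * (binom_ratio p k - of_nat (p choose k) * (1 - of_nat p * harmonic k))
      - of_nat p ^ 2 * (of_int (chi3 (int k))
          * (1 / of_nat k * (harmonic k * (of_nat ((p - 1) choose (k - 1)) - (-1) ^ (k - 1))))))"
    unfolding chi_harmonic_sum_def sum_distrib_left sum.distrib[symmetric] sum_subtractf[symmetric]
  proof (intro sum.cong refl)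
    fix k assume "k \<in> {1..p-1}"
    then have k: "k \<ge> 1" by simp
    then have e: "signed_chi k = (-1) ^ (k - 1) * of_int (chi3 (int k))"
      unfolding signed_chi_def by (cases k) auto
    show "of_int (chi3 (int k)) * binom_ratio p k
        + of_nat p ^ 2 * (signed_chi k * (1 / of_nat k * harmonic k))
        - of_int (chi3 (int k)) * of_nat (p choose k)
      = of_int (chi3 (int k)) * (binom_ratio p k - of_nat (p choose k) * (1 - of_nat p * harmonic k))
      - of_nat p ^ 2 * (of_int (chi3 (int k))
          * (1 / of_nat k * (harmonic k * (of_nat ((p - 1) choose (k - 1)) - (-1) ^ (k - 1)))))"
      unfolding e choose_p[OF k] divide_inverse by (simp add: algebra_simps power2_eq_square)
  qed
  also have "\<dots> \<in> J 3"
  proof (intro J_sum J_diff)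
    fix k assume "k \<in> {1..p-1}"
    then have k: "1 \<le> k" "0 < k" "k < p" "k - 1 < p" using p_pos by auto
    define H where "H = of_nat p ^ 1 * harmonic k"
    define e where "e = of_nat ((p + k) choose k) - 1 - H"
    have H: "H \<in> J 1" unfolding H_def using J_harmonic[OF k(3)] by blast
    have e: "e \<in> J 2" unfolding e_def H_def using J_choose_add[OF k(3)] by simp
    have H0: "1 - H \<in> J 0" using J_mono[OF H] by auto
    have HH: "H * H \<in> J 2" using J_mult[OF H H] by (simp add: numeral_2_eq_2)
    have "binom_ratio p k * (H * H - (1 - H) * e) \<in> J 3"
      using J_mult[OF J_binom_ratio_p[OF k(1,3)] J_diff[OF HH J_mult_left[OF H0 e]]]
          by (simp add: numeral_3_eq_3)
    \<comment> \<open>Multiply out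
      \<open>(1 + H + e) (1 - H) = 1 - H * H + (1 - H) * e\<close>.\<close>
    moreover have "binom_ratio p k - of_nat (p choose k) * (1 - of_nat p * harmonic k)
        = binom_ratio p k * (H * H - (1 - H) * e)"
    proof -
      have "(of_nat (p choose k) :: rat) = binom_ratio p k * (1 + H + e)"
        using binom_ratio_choose[of k p] k unfolding e_def by simp
      then show ?thesis by (simp add: H_def algebra_simps)
    qed
    ultimately show "of_int (chi3 (int k))
        * (binom_ratio p k - of_nat (p choose k) * (1 - of_nat p * harmonic k)) \<in> J 3"
      by (simp only: J_mult_left J_of_int)
    have "of_nat p ^ 2 * (of_int (chi3 (int k))
        * (1 / of_nat k * (harmonic k * (of_nat ((p - 1) choose (k - 1)) - (-1) ^ (k - 1)))))
        \<in> J (2 + 1)"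
      by (rule J_mult[OF J_p_power J_mult_left[OF J_of_int J_mult_left[OF J_inverse_less[OF k(2,3)]
            J_mult_left[OF J_harmonic[OF k(3)] J_choose_pred_weak[OF k(4)]]]]])
    then show "of_nat p ^ 2
        * (of_int (chi3 (int k))
        * (1 / of_nat k * (harmonic k * (of_nat ((p - 1) choose (k - 1)) - (-1) ^ (k - 1))))) \<in> J 3"
      by simp
  qed
  finally show ?thesis .
qed

text \<open>Two exact evaluations, expanded modulo \<open>p^2\<close>, relate
  \<open>V = chi_sum1\<close>, \<open>T = chi_harmonic_sum\<close> and \<open>U = chi_sum2\<close>:
  the row \<open>n = p\<close> gives \<open>V - p T + p U = 0\<close>, the row
  \<open>n = p - 1\<close> gives \<open>2 V - p T = 0\<close>. Eliminating \<open>V\<close> and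
  dividing by \<open>p\<close> leaves \<open>T = 2 U\<close> modulo \<open>p\<close>.\<close>

lemma J_chi_harmonic_sum2: "chi_harmonic_sum - 2 * chi_sum2 \<in> J 1"
proof -
  have "of_nat p * (\<Sum>k=1..p-1. of_int (chi3 (int k))
      * (1 / of_nat k * of_nat ((p - 1) choose (k - 1)))) = (0 :: rat)"
  proof -
    have "of_nat p * (\<Sum>k=1..p-1. of_int (chi3 (int k))
        * (1 / of_nat k * of_nat ((p - 1) choose (k - 1))))
      = (\<Sum>k=1..p-1. of_int (chi3 (int k)) * (of_nat (p choose k) :: rat))"
      unfolding sum_distrib_left by (intro sum.cong refl) (simp add: choose_p)
    then show ?thesis by (simp only: sum_choose_p_chi)
  qed
  then have 0: "(\<Sum>k=1..p-1. of_int (chi3 (int k))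
      * (1 / of_nat k * of_nat ((p - 1) choose (k - 1)))) = (0 :: rat)"
    using p_nonzero by (simp only: mult_eq_0_iff) simp
  have "chi_sum1 - of_nat p * chi_harmonic_sum + of_nat p * chi_sum2 =
    (\<Sum>k=1..p-1. signed_chi k * (1 / of_nat k)
        - of_nat p * (signed_chi k * (1 / of_nat k * harmonic k))
        + of_nat p * (signed_chi k * (1 / of_nat k ^ 2))
      - of_int (chi3 (int k)) * (1 / of_nat k * of_nat ((p - 1) choose (k - 1))))"
    unfolding sum_subtractf 0 sum.distrib chi_sum1_def chi_harmonic_sum_def chi_sum2_def
        sum_distrib_left by simp
  also have "\<dots> = (\<Sum>k=1..p-1. - (of_int (chi3 (int k)) * (1 / of_nat k *
      (of_nat ((p - 1) choose (k - 1)) - (-1) ^ (k - 1) * (1 - of_nat p * harmonic (k - 1))))))"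
  proof (intro sum.cong refl)
    fix k assume "k \<in> {1..p-1}"
    then obtain l where l: "k = Suc l" by (cases k) auto
    \<comment> \<open>The expansion of \<open>binom(p-1,k-1)\<close> involves
      \<open>harmonic (k - 1)\<close>; the shift to \<open>harmonic k\<close> is the source of
      \<open>chi_sum2\<close>.\<close>
    have h: "harmonic k = harmonic l + 1 / of_nat k" unfolding harmonic_def l by simp
    have e: "signed_chi k = (-1) ^ l * of_int (chi3 (int k))"
      unfolding signed_chi_def l by simp
    have kl: "k - 1 = l" by (simp add: l)
    have s: "1 / of_nat k ^ 2 = 1 / of_nat k * (1 / of_nat k :: rat)" by (simp add: power2_eq_square)
    show "signed_chi k * (1 / of_nat k) - of_nat p * (signed_chi k * (1 / of_nat k * harmonic k))
        + of_nat p * (signed_chi k * (1 / of_nat k ^ 2))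
      - of_int (chi3 (int k)) * (1 / of_nat k * of_nat ((p - 1) choose (k - 1)))
          = - (of_int (chi3 (int k)) * (1 / of_nat k *
      (of_nat ((p - 1) choose (k - 1)) - (-1) ^ (k - 1) * (1 - of_nat p * harmonic (k - 1)))))"
      unfolding e h kl s
      by (simp only: algebra_simps)
  qed
  also have "\<dots> \<in> J 2"
  proof (intro J_sum J_uminus)
    fix k assume "k \<in> {1..p-1}"
    then have k: "0 < k" "k < p" "k - 1 < p" using p_pos by auto
    show "of_int (chi3 (int k))
        * (1 / of_nat k * (of_nat ((p - 1) choose (k - 1))
        - (-1) ^ (k - 1) * (1 - of_nat p * harmonic (k - 1)))) \<in> J 2"
      by (rule J_mult_left[OF J_of_int J_mult_left[OF J_inverse_less[OF k(1,2)] J_choose_pred[OF k(3)]]])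
  qed
  finally have 1: "chi_sum1 - of_nat p * chi_harmonic_sum + of_nat p * chi_sum2 \<in> J 2" .
  \<comment> \<open>The binomial sum for \<open>n = p - 1\<close> equals \<open>chi_sum1\<close>
    exactly, while its expansion modulo \<open>p^2\<close> starts with \<open>- chi_sum1\<close>;
    hence the factor 2 below.\<close>
  have c: "(\<Sum>k=1..p-1. of_nat ((p - 1) choose k) * of_int (chi3 (int k)) / of_nat k) = chi_sum1"
    unfolding sum_choose_chi_div chi_sum1_def signed_chi_def by simp
  have "(\<Sum>k=1..p-1. of_int (chi3 (int k))
      * (1 / of_nat k * (of_nat ((p - 1) choose k) - (-1) ^ k * (1 - of_nat p * harmonic k))))
     = (\<Sum>k=1..p-1. of_nat ((p - 1) choose k) * of_int (chi3 (int k)) / of_nat k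
         + signed_chi k * (1 / of_nat k) - of_nat p * (signed_chi k * (1 / of_nat k * harmonic k)))"
    unfolding divide_inverse by (intro sum.cong refl) (simp add: signed_chi_def algebra_simps)
  also have "\<dots> = 2 * chi_sum1 - of_nat p * chi_harmonic_sum"
    unfolding sum_subtractf sum.distrib c chi_sum1_def[symmetric] sum_distrib_left[symmetric]
        chi_harmonic_sum_def[symmetric] by simp
  finally have "2 * chi_sum1 - of_nat p * chi_harmonic_sum
      = (\<Sum>k=1..p-1. of_int (chi3 (int k))
      * (1 / of_nat k * (of_nat ((p - 1) choose k) - (-1) ^ k * (1 - of_nat p * harmonic k))))" ..
  also have "\<dots> \<in> J 2"
  proof (intro J_sum)
    fix k assume "k \<in> {1..p-1}"
    then have k: "0 < k" "k < p" using p_pos by auto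
    show "of_int (chi3 (int k))
        * (1 / of_nat k * (of_nat ((p - 1) choose k) - (-1) ^ k * (1 - of_nat p * harmonic k))) \<in> J 2"
      by (rule J_mult_left[OF J_of_int J_mult_left[OF J_inverse_less[OF k] J_choose_pred[OF k(2)]]])
  qed
  finally have 2: "2 * chi_sum1 - of_nat p * chi_harmonic_sum \<in> J 2" .
  have "(2 * chi_sum1 - of_nat p * chi_harmonic_sum)
      - 2 * (chi_sum1 - of_nat p * chi_harmonic_sum + of_nat p * chi_sum2) \<in> J 2"
    by (rule J_diff[OF 2 J_mult_left[OF J_numeral 1]])
  moreover have "(2 * chi_sum1 - of_nat p * chi_harmonic_sum)
      - 2 * (chi_sum1 - of_nat p * chi_harmonic_sum + of_nat p * chi_sum2)
      = of_nat p ^ 1 * (chi_harmonic_sum - 2 * chi_sum2)"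
    by (simp add: algebra_simps)
  ultimately have "of_nat p ^ 1 * (chi_harmonic_sum - 2 * chi_sum2) \<in> J (1 + 1)"
      by (simp add: numeral_2_eq_2)
  then show ?thesis by (rule J_p_power_cancel)
qed

text \<open>Chains the reductions modulo \<open>p^3\<close>: \<open>-Y\<close> becomes
  \<open>p^2 T\<close>, then \<open>2 p^2 U\<close>, then \<open>p^2 b / 6\<close>, with
  \<open>T = chi_harmonic_sum\<close> and \<open>U = chi_sum2\<close>.\<close>

lemma J_apery_congruence:
  "(1 / of_nat p) * (\<Sum>k<p. (-1)^k * of_nat (2 * k + 1) * of_nat (apery k))
    - (of_int (chi3 (int p)) + of_nat p ^ 2 / 6 * bernoulli_poly (p - 2) (1 / 3)) \<in> J 3"
proof -
  define S where "S = (1 / of_nat p) * (\<Sum>k<p. (-1)^k * of_nat (2 * k + 1) * of_nat (apery k) :: rat)"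
  define b where "b = bernoulli_poly (p - 2) (1 / 3)"
  have 1: "S - (of_int (chi3 (int p)) - chi_ratio_sum) \<in> J 3" unfolding S_def by (rule J_apery_sum)
  have 2: "of_nat p ^ 2 * (chi_harmonic_sum - 2 * chi_sum2) \<in> J (2 + 1)"
      by (rule J_mult[OF J_p_power J_chi_harmonic_sum2])
  have 3: "of_nat p ^ 2 * (2 * (chi_sum2 - b / 12)) \<in> J (2 + 1)"
    unfolding b_def by (rule J_mult[OF J_p_power J_mult_left[OF J_numeral J_chi_sum2]])
  have "(S - (of_int (chi3 (int p)) - chi_ratio_sum))
      - (chi_ratio_sum + of_nat p ^ 2 * chi_harmonic_sum)
      + of_nat p ^ 2 * (chi_harmonic_sum - 2 * chi_sum2) + of_nat p ^ 2 * (2 * (chi_sum2 - b / 12))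
      \<in> J 3"
    using 2 3 by (intro J_add[OF J_add[OF J_diff[OF 1 J_chi_ratio_harmonic]]]) simp_all
  moreover have "(S - (of_int (chi3 (int p)) - chi_ratio_sum))
      - (chi_ratio_sum + of_nat p ^ 2 * chi_harmonic_sum)
      + of_nat p ^ 2 * (chi_harmonic_sum - 2 * chi_sum2) + of_nat p ^ 2 * (2 * (chi_sum2 - b / 12))
    = S - (of_int (chi3 (int p)) + of_nat p ^ 2 / 6 * b)"
    by (simp add: algebra_simps)
  ultimately show ?thesis unfolding S_def b_def by (simp only:)
qed

end

section \<open>Identification of the character with the Legendre symbol, and conclusion\<close>

lemma Legendre_3: "Legendre a 3 = chi3 a"
proof -
  have q: "QuadRes 3 a \<longleftrightarrow> a mod 3 = 0 \<or> a mod 3 = 1"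
  proof
    assume "QuadRes 3 a"
    then obtain y where y: "y\<^sup>2 mod 3 = a mod 3" by (auto simp: QuadRes_def cong_def)
    have "y\<^sup>2 mod 3 = (y mod 3)\<^sup>2 mod 3" by (simp add: power_mod)
    moreover obtain r where "y mod 3 = r" "r \<in> {0, 1, 2}" using mod_3_cases by blast
    ultimately show "a mod 3 = 0 \<or> a mod 3 = 1" using y by auto
  next
    assume "a mod 3 = 0 \<or> a mod 3 = 1"
    then have "[0\<^sup>2 = a] (mod 3) \<or> [1\<^sup>2 = a] (mod 3)" by (auto simp: cong_def)
    then show "QuadRes 3 a" unfolding QuadRes_def by blast
  qed
  obtain r where "a mod 3 = r" "r \<in> {0, 1, 2}" using mod_3_cases by blast
  then show ?thesis unfolding Legendre_def q chi3_def by (auto simp: cong_def)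
qed

theorem theorem1p1:
  fixes p :: nat
  assumes "prime p" and "p > 3"
  shows "rat_cong
           ((1 / of_nat p) * (\<Sum>k<p. (-1)^k * of_nat (2 * k + 1) * of_nat (apery k)))
           (of_int (Legendre (int p) 3)
              + (of_nat p)^2 / 6 * bernoulli_poly (p - 2) (1 / 3))
           (int p) 3"
proof -
  interpret prime_localization_gt3 p
    using assms by unfold_locales
  show ?thesis
    unfolding rat_cong_iff_J Legendre_3 by (rule J_apery_congruence)
qed

end
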